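(* Let $\mathfrak{s}$ be a finite-dimensional Lie algebra over $\mathbb{R}$ or $\mathbb{C}$, and assume that $\mathfrak{s}$ is a semidirect sum $\mathfrak{s}=\mathfrak{r}+\mathfrak{u}$, where $\mathfrak{u}$ is an abelian ideal in $\mathfrak{s}$, $\mathfrak{r}$ is a semisimple Lie subalgebra of $\mathfrak{s}$, and $\mathfrak{u}^{\mathfrak{r}}=0$. Let $\gamma\in\mathfrak{s}^*$ and write $\gamma=\mu+\lambda$ with $\mu\in\mathfrak{r}^*$ and $\lambda\in\mathfrak{u}^*$, with respect to the decomposition $\mathfrak{s}^*=\mathfrak{r}^*+\mathfrak{u}^*$. Then $\mathfrak{s}\cdot\gamma=\mathfrak{r}\cdot\gamma$ if and only if $\lambda=0$.
   Context: $\mathfrak{u}^{\mathfrak{r}}=\{y\in\mathfrak{u}:[x,y]=0\text{ for all }x\in\mathfrak{r}\}$. The decomposition $\mathfrak{s}^*=\mathfrak{r}^*+\mathfrak{u}^*$ is dual to the vector space decomposition $\mathfrak{s}=\mathfrak{r}\oplus\mathfrak{u}$: $\mathfrak{r}^*$ is identified with the functionals vanishing on $\mathfrak{u}$, and $\mathfrak{u}^*$ with those vanishing on $\mathfrak{r}$. The dot denotes the coadjoint action, $(x\cdot\gamma)(y)=-\gamma([x,y])$; for a subspace $\mathfrak{a}\subset\mathfrak{s}$, $\mathfrak{a}\cdot\gamma=\{x\cdot\gamma:x\in\mathfrak{a}\}\subset\mathfrak{s}^*$. *)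

theory Defs imports Complex_Main begin

text \<open>
  Lie algebras live on a whole type, with scalar multiplication and bracket as parameters;
  subalgebras and ideals are subsets of that type.
\<close>

locale lie_algebra = vector_space scale
  for scale :: "'k::field \<Rightarrow> 'a::ab_group_add \<Rightarrow> 'a" +
  fixes bracket :: "'a \<Rightarrow> 'a \<Rightarrow> 'a"
  assumes bracket_add_left: "bracket (x + y) z = bracket x z + bracket y z"
    and bracket_add_right: "bracket x (y + z) = bracket x y + bracket x z"
    and bracket_scale_left: "bracket (scale c x) y = scale c (bracket x y)"
    and bracket_scale_right: "bracket x (scale c y) = scale c (bracket x y)"
    and bracket_self: "bracket x x = 0"
    and jacobi: "bracket x (bracket y z) + bracket y (bracket z x) + bracket z (bracket x y) = 0"
begin

definition lie_subalgebra :: "'a set \<Rightarrow> bool" where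
  "lie_subalgebra A \<longleftrightarrow> subspace A \<and> (\<forall>x\<in>A. \<forall>y\<in>A. bracket x y \<in> A)"

definition lie_ideal :: "'a set \<Rightarrow> 'a set \<Rightarrow> bool" where
  "lie_ideal I A \<longleftrightarrow> subspace I \<and> I \<subseteq> A \<and> (\<forall>x\<in>A. \<forall>y\<in>I. bracket x y \<in> I)"

definition abelian :: "'a set \<Rightarrow> bool" where
  "abelian A \<longleftrightarrow> (\<forall>x\<in>A. \<forall>y\<in>A. bracket x y = 0)"

primrec derived_series :: "'a set \<Rightarrow> nat \<Rightarrow> 'a set" where
  "derived_series A 0 = A"
| "derived_series A (Suc n) =
     span {bracket x y | x y. x \<in> derived_series A n \<and> y \<in> derived_series A n}"

definition solvable :: "'a set \<Rightarrow> bool" where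
  "solvable A \<longleftrightarrow> (\<exists>n. derived_series A n = {0})"

text \<open>Semisimple means that the radical vanishes; the zero algebra counts as semisimple.\<close>

definition semisimple :: "'a set \<Rightarrow> bool" where
  "semisimple A \<longleftrightarrow> (\<forall>I. lie_ideal I A \<and> solvable I \<longrightarrow> I = {0})"

definition semidirect_sum :: "'a set \<Rightarrow> 'a set \<Rightarrow> bool" where
  "semidirect_sum r u \<longleftrightarrow>
     lie_subalgebra r \<and> lie_ideal u UNIV \<and> r \<inter> u = {0} \<and> {x + y | x y. x \<in> r \<and> y \<in> u} = UNIV"

text \<open>The subspace of \<open>u\<close> annihilated by the adjoint action of \<open>r\<close>.\<close>

definition invariants :: "'a set \<Rightarrow> 'a set \<Rightarrow> 'a set" where
  "invariants r u = {y \<in> u. \<forall>x\<in>r. bracket x y = 0}"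

definition dual :: "('a \<Rightarrow> 'k) set" where
  "dual = {f. Vector_Spaces.linear scale (*) f}"

text \<open>
  For a decomposition of the space as \<open>r \<oplus> u\<close>, the dual of \<open>r\<close> is \<open>annihilator u\<close>
  and the dual of \<open>u\<close> is \<open>annihilator r\<close>.
\<close>

definition annihilator :: "'a set \<Rightarrow> ('a \<Rightarrow> 'k) set" where
  "annihilator A = {f \<in> dual. \<forall>x\<in>A. f x = 0}"

definition coadjoint :: "'a \<Rightarrow> ('a \<Rightarrow> 'k) \<Rightarrow> 'a \<Rightarrow> 'k" where
  "coadjoint x f = (\<lambda>y. - f (bracket x y))"

definition coadjoint_image :: "'a set \<Rightarrow> ('a \<Rightarrow> 'k) \<Rightarrow> ('a \<Rightarrow> 'k) set" where
  "coadjoint_image A f = {coadjoint x f | x. x \<in> A}"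

end

locale finite_dim_lie_algebra = lie_algebra scale bracket
  for scale :: "'k::field \<Rightarrow> 'a::ab_group_add \<Rightarrow> 'a" and bracket +
  assumes finite_dim: "\<exists>B. finite B \<and> span B = UNIV"

end

theory Submission
  imports Defs "HOL-Computational_Algebra.Fundamental_Theorem_Algebra" "HOL-Library.Function_Algebras"
begin

text \<open>
  If \<open>\<nu> = 0\<close> then \<open>\<gamma>\<close> vanishes on the ideal \<open>u\<close>, so \<open>u\<close> acts trivially on \<open>\<gamma>\<close>.  Conversely, equality of the two
  images says that for every \<open>y \<in> u\<close> there is \<open>x \<in> r\<close> stabilizing \<open>\<nu>\<close> with \<open>\<nu> [y,z] = \<mu> [x,z]\<close> for all
  \<open>z \<in> r\<close>.  This property passes to every submodule \<open>U\<close> of \<open>u\<close>, so one proves \<open>\<nu> = 0\<close> on \<open>U\<close> by induction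
  on its dimension.  By Cartan's criterion, \<open>r\<close> is the direct sum of the kernel of its action on \<open>U\<close> and an
  ideal \<open>K\<close> on which the trace form of \<open>U\<close> is nondegenerate.  Let \<open>\<Omega>\<close> be the corresponding Casimir operator
  on \<open>U\<close>.  The property implies \<open>\<nu> \<circ> \<Omega> = 0\<close>.  Since \<open>\<Omega>\<close> has trace \<open>dim K\<close>, it is not nilpotent unless \<open>r\<close>
  acts trivially; the Fitting decomposition \<open>U = ker \<Omega>^n + im \<Omega>^n\<close> then reduces \<open>\<nu> = 0\<close> to the proper
  submodule \<open>ker \<Omega>^n\<close>.
\<close>

section \<open>Traces of endomorphisms of subspaces\<close>

text \<open>The Casimir operator need not be invertible on \<open>U\<close>, because
  \<open>U\<close> may be reducible; knowing \<open>\<nu>\<close> on its image therefore does not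
  settle the matter, and the nilpotent summand takes the place that complete reducibility would
  otherwise have. Cartan's criterion rests on perfect subalgebras: the derived series of a
  finite-dimensional algebra stabilizes at a perfect one, and if the trace form vanishes there, all
  its elements act nilpotently and Engel's theorem makes the action trivial. This replaces Lie's
  theorem. Nilpotency is a statement about eigenvalues, hence the passage to complex operators.
  There the test operator is the conjugate of the semisimple part, defined directly on generalized
  eigenspaces. It normalizes \<open>J\<close> because \<open>J\<close> is spanned by generalized
  eigenvectors of \<open>ad x\<close> that lie in \<open>J\<close>, which is why the eigenspace
  lemmas carry an invariant subspace along.\<close>

locale linear_space = vector_space scale
  for scale :: "'a::field \<Rightarrow> 'b::ab_group_add \<Rightarrow> 'b" (infixr \<open>*s\<close> 75)
begin

text \<open>A property of subsets, because the ambient spaces met later, such as all functions into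
  \<open>complex\<close> and the operators on them, are in general not finite-dimensional.\<close>

definition fin_dim :: "'b set \<Rightarrow> bool" where
  "fin_dim U \<longleftrightarrow> (\<exists>B. finite B \<and> U \<subseteq> span B)"

lemma fin_dim_subset: "fin_dim U \<Longrightarrow> W \<subseteq> U \<Longrightarrow> fin_dim W"
  unfolding fin_dim_def by blast

lemma fin_dim_independent_finite:
  assumes "fin_dim U" "independent B" "B \<subseteq> U"
  shows "finite B"
  using assms independent_span_bound unfolding fin_dim_def by blast

lemma fin_dim_basis_extending:
  assumes "fin_dim U" "subspace U" "independent C" "C \<subseteq> U"
  obtains B where "finite B" "independent B" "span B = U" "C \<subseteq> B"
proof -
  obtain B where B: "C \<subseteq> B" "B \<subseteq> U" "independent B" "U \<subseteq> span B"
    using maximal_independent_subset_extend assms(3,4) by metis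
  moreover have "span B = U"
    using B assms(2) by (simp add: span_minimal subset_antisym)
  ultimately show thesis
    using that fin_dim_independent_finite[OF assms(1)] by blast
qed

lemma fin_dim_basis:
  assumes "fin_dim U" "subspace U"
  obtains B where "finite B" "independent B" "span B = U"
  by (rule fin_dim_basis_extending[OF assms independent_empty]) (use that in auto)

abbreviation endo :: "('b \<Rightarrow> 'b) \<Rightarrow> bool" where
  "endo \<equiv> Vector_Spaces.linear scale scale"

lemma endo_iff: "endo f \<longleftrightarrow> (\<forall>x y. f (x + y) = f x + f y) \<and> (\<forall>c x. f (c *s x) = c *s f x)"
  using vector_space_axioms by (simp add: Vector_Spaces.linear_iff)

lemma endo_add: "endo f \<Longrightarrow> f (x + y) = f x + f y"
  and endo_scale: "endo f \<Longrightarrow> f (c *s x) = c *s f x"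
  by (simp_all add: endo_iff)

lemma endo_zero: "endo f \<Longrightarrow> f 0 = 0"
  using endo_scale[of f 0 0] by simp

lemma endo_neg: "endo f \<Longrightarrow> f (- x) = - f x"
  using endo_add[of f x "- x"] by (simp add: endo_zero eq_neg_iff_add_eq_0 add.commute)

lemma endo_diff: "endo f \<Longrightarrow> f (x - y) = f x - f y"
  using endo_add[of f x "- y"] by (simp add: endo_neg)

lemma endo_sum: "endo f \<Longrightarrow> f (\<Sum>i\<in>I. g i) = (\<Sum>i\<in>I. f (g i))"
  by (induction I rule: infinite_finite_induct) (simp_all add: endo_zero endo_add)

lemma endo_compose: "endo f \<Longrightarrow> endo g \<Longrightarrow> endo (\<lambda>v. f (g v))"
  by (simp add: endo_iff)

lemma endo_funpow: "endo f \<Longrightarrow> endo (f ^^ n)"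
  by (induction n) (simp_all add: endo_iff)

lemma endo_maps_span:
  assumes "endo f" "\<And>b. b \<in> B \<Longrightarrow> f b \<in> W" "subspace W" "v \<in> span B"
  shows "f v \<in> W"
  using assms(4)
proof (induction rule: span_induct_alt)
  case base
  then show ?case using assms by (simp add: endo_zero subspace_0)
next
  case (step c x y)
  then show ?case using assms by (simp add: endo_add endo_scale subspace_add subspace_scale)
qed

lemma endo_image_subspace:
  assumes "endo f" "subspace U"
  shows "subspace (f ` U)"
proof (rule subspaceI)
  show "0 \<in> f ` U"
    using endo_zero[OF assms(1)] subspace_0[OF assms(2)] by (metis imageI)
next
  fix x y assume "x \<in> f ` U" "y \<in> f ` U"
  then obtain a b where "x = f a" "y = f b" "a \<in> U" "b \<in> U" by blast
  then show "x + y \<in> f ` U"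
    using endo_add[OF assms(1), of a b] subspace_add[OF assms(2)] by (metis imageI)
next
  fix c x assume "x \<in> f ` U"
  then obtain a where "x = f a" "a \<in> U" by blast
  then show "c *s x \<in> f ` U"
    using endo_scale[OF assms(1), of c a] subspace_scale[OF assms(2)] by (metis imageI)
qed

text \<open>Extending \<open>B\<close> to a basis of the whole space makes each coordinate linear
  everywhere. Additivity of the trace can then be proved for arbitrary maps, before asking whether
  they preserve the subspace.\<close>

definition coord :: "'b set \<Rightarrow> 'b \<Rightarrow> 'b \<Rightarrow> 'a" where
  "coord B v b = representation (extend_basis B) v b"

lemma coord_linear:
  assumes "independent B"
  shows "coord B (u + v) b = coord B u b + coord B v b"
    and "coord B (c *s v) b = c * coord B v b"
  using assms unfolding coord_def
  by (simp_all add: representation_add representation_scale independent_extend_basis)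

lemma coord_eq_representation:
  assumes "independent B" "v \<in> span B"
  shows "coord B v = representation B v"
  unfolding coord_def
  using representation_extend[OF independent_extend_basis[OF assms(1)] assms(2) extend_basis_superset[OF assms(1)]]
  by auto

definition subspace_trace :: "'b set \<Rightarrow> ('b \<Rightarrow> 'b) \<Rightarrow> 'a" where
  "subspace_trace U f =
    (let B = (SOME B. independent B \<and> span B = U) in \<Sum>b\<in>B. coord B (f b) b)"

text \<open>Expanding \<open>f b\<close> in \<open>C\<close> and \<open>g c\<close> in
  \<open>B\<close> turns both sides into the same double sum of products of matrix entries. Taking
  \<open>g\<close> to be the identity gives independence of the basis; taking \<open>B = C\<close>
  gives the commutation rule under a trace.\<close>

lemma trace_cyclic_bases:
  assumes B: "finite B" "independent B" and C: "finite C" "independent C"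
    and f: "endo f" "f ` span B \<subseteq> span C" and g: "endo g" "g ` span C \<subseteq> span B"
  shows "(\<Sum>b\<in>B. representation B (g (f b)) b) = (\<Sum>c\<in>C. representation C (f (g c)) c)"
proof -
  have 1: "representation B (g (f b)) b = (\<Sum>c\<in>C. representation C (f b) c * representation B (g c) b)"
    if "b \<in> B" for b
  proof -
    have "f b \<in> span C" using that f by (auto intro: span_base)
    then have "g (f b) = g (\<Sum>c\<in>C. representation C (f b) c *s c)"
      using C by (simp add: sum_representation_eq)
    then have eq: "g (f b) = (\<Sum>c\<in>C. representation C (f b) c *s g c)"
      using g by (simp add: endo_sum endo_scale)
    have "g c \<in> span B" if "c \<in> C" for c using that g by (auto intro: span_base)
    then show ?thesis
      unfolding eq using B by (simp add: representation_sum representation_scale span_scale)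
  qed
  have 2: "representation C (f (g c)) c = (\<Sum>b\<in>B. representation B (g c) b * representation C (f b) c)"
    if "c \<in> C" for c
  proof -
    have "g c \<in> span B" using that g by (auto intro: span_base)
    then have "f (g c) = f (\<Sum>b\<in>B. representation B (g c) b *s b)"
      using B by (simp add: sum_representation_eq)
    then have eq: "f (g c) = (\<Sum>b\<in>B. representation B (g c) b *s f b)"
      using f by (simp add: endo_sum endo_scale)
    have "f b \<in> span C" if "b \<in> B" for b using that f by (auto intro: span_base)
    then show ?thesis
      unfolding eq using C by (simp add: representation_sum representation_scale span_scale)
  qed
  show ?thesis
    using sum.swap[of "\<lambda>b c. representation C (f b) c * representation B (g c) b" C B]
    by (simp add: 1 2 mult.commute)
qed

lemma endo_id: "endo (\<lambda>v. v)"
  by (simp add: endo_iff)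

lemma subspace_trace_basis:
  assumes "finite C" "independent C" "span C = U" "endo f" "f ` U \<subseteq> U"
  shows "subspace_trace U f = (\<Sum>c\<in>C. representation C (f c) c)"
proof -
  define B where "B = (SOME B. independent B \<and> span B = U)"
  have B: "independent B" "span B = U"
    using someI[of "\<lambda>B. independent B \<and> span B = U" C] assms unfolding B_def by auto
  then have "finite B"
    using assms fin_dim_independent_finite[of U B] unfolding fin_dim_def by (metis span_superset subset_refl)
  have "f b \<in> span B" if "b \<in> B" for b
    using that assms(5) B by (auto intro: span_base)
  then have "subspace_trace U f = (\<Sum>b\<in>B. representation B (f b) b)"
    unfolding subspace_trace_def B_def[symmetric] Let_def
    using B by (simp add: coord_eq_representation)
  also have "\<dots> = (\<Sum>c\<in>C. representation C (f c) c)"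
    using trace_cyclic_bases[OF \<open>finite B\<close> B(1) assms(1,2), of f "\<lambda>v. v"] assms B
    by (simp add: endo_id)
  finally show ?thesis .
qed

lemma subspace_trace_commute:
  assumes "fin_dim U" "subspace U" "endo f" "f ` U \<subseteq> U" "endo g" "g ` U \<subseteq> U"
  shows "subspace_trace U (\<lambda>v. f (g v)) = subspace_trace U (\<lambda>v. g (f v))"
proof -
  obtain B where B: "finite B" "independent B" "span B = U"
    by (rule fin_dim_basis[OF assms(1,2)])
  have "subspace_trace U (\<lambda>v. f (g v)) = (\<Sum>c\<in>B. representation B (f (g c)) c)"
    using assms B by (intro subspace_trace_basis endo_compose[OF assms(3,5)]) auto
  also have "\<dots> = (\<Sum>c\<in>B. representation B (g (f c)) c)"
    using trace_cyclic_bases[OF B(1,2) B(1,2), of g f] assms B by simp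
  also have "\<dots> = subspace_trace U (\<lambda>v. g (f v))"
    using assms B by (intro subspace_trace_basis[symmetric] endo_compose[OF assms(5,3)]) auto
  finally show ?thesis .
qed

lemma subspace_trace_add:
  assumes "subspace U"
  shows "subspace_trace U (\<lambda>v. f v + g v) = subspace_trace U f + subspace_trace U g"
    and "subspace_trace U (\<lambda>v. c *s f v) = c * subspace_trace U f"
proof -
  define B where "B = (SOME B. independent B \<and> span B = U)"
  obtain C where "C \<subseteq> U" "independent C" "U \<subseteq> span C"
    using maximal_independent_subset by blast
  then have "independent C \<and> span C = U"
    using assms by (simp add: span_minimal subset_antisym)
  then have "independent B"
    using someI[of "\<lambda>B. independent B \<and> span B = U" C] unfolding B_def by auto
  then show "subspace_trace U (\<lambda>v. f v + g v) = subspace_trace U f + subspace_trace U g"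
    and "subspace_trace U (\<lambda>v. c *s f v) = c * subspace_trace U f"
    unfolding subspace_trace_def B_def[symmetric] Let_def
    by (simp_all add: coord_linear sum.distrib sum_distrib_left)
qed

lemma subspace_trace_zero: "subspace U \<Longrightarrow> subspace_trace U (\<lambda>v. 0) = 0"
  using subspace_trace_add(2)[of U 0 "\<lambda>v. v"] by simp

lemma subspace_trace_neg: "subspace U \<Longrightarrow> subspace_trace U (\<lambda>v. - f v) = - subspace_trace U f"
  using subspace_trace_add(2)[of U "-1" f] by simp

lemma subspace_trace_diff:
  "subspace U \<Longrightarrow> subspace_trace U (\<lambda>v. f v - g v) = subspace_trace U f - subspace_trace U g"
  using subspace_trace_add(1)[of U f "\<lambda>v. - g v"] by (simp add: subspace_trace_neg)

lemma subspace_trace_sum: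
  "subspace U \<Longrightarrow> subspace_trace U (\<lambda>v. \<Sum>i\<in>I. f i v) = (\<Sum>i\<in>I. subspace_trace U (f i))"
  by (induction I rule: infinite_finite_induct) (simp_all add: subspace_trace_zero subspace_trace_add)

lemma subspace_trace_cong:
  assumes "subspace U" "\<And>v. v \<in> U \<Longrightarrow> f v = g v"
  shows "subspace_trace U f = subspace_trace U g"
proof -
  define B where "B = (SOME B. independent B \<and> span B = U)"
  obtain C where "C \<subseteq> U" "independent C" "U \<subseteq> span C"
    using maximal_independent_subset by blast
  then have "independent C \<and> span C = U"
    using assms by (simp add: span_minimal subset_antisym)
  then have "span B = U"
    using someI[of "\<lambda>B. independent B \<and> span B = U" C] unfolding B_def by auto
  then have "f b = g b" if "b \<in> B" for b
    using that assms(2) by (auto intro: span_base)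
  then show ?thesis
    unfolding subspace_trace_def B_def[symmetric] Let_def by simp
qed

text \<open>A basis of \<open>N\<close> extended to one of \<open>U\<close> gains only vectors along
  which every \<open>f b\<close> has coordinate zero.\<close>

lemma subspace_trace_range:
  assumes "fin_dim U" "subspace U" "subspace N" "N \<subseteq> U" "endo f" "f ` U \<subseteq> N"
  shows "subspace_trace U f = subspace_trace N f"
proof -
  obtain C where C: "finite C" "independent C" "span C = N"
    by (rule fin_dim_basis[OF fin_dim_subset[OF assms(1,4)] assms(3)])
  then have "C \<subseteq> U" using assms(4) span_superset by blast
  then obtain B where B: "finite B" "independent B" "span B = U" "C \<subseteq> B"
    by (rule fin_dim_basis_extending[OF assms(1,2) C(2)])
  have rep: "representation B (f b) = representation C (f b)" if "b \<in> B" for b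
  proof (rule representation_extend[OF B(2) _ B(4)])
    have "b \<in> U" using that B(3) span_base by blast
    then show "f b \<in> span C" using assms(6) C(3) by blast
  qed
  have "subspace_trace U f = (\<Sum>b\<in>B. representation C (f b) b)"
    using subspace_trace_basis[OF B(1-3) assms(5)] assms(4,6) rep by auto
  also have "\<dots> = (\<Sum>b\<in>C. representation C (f b) b)"
    using B representation_ne_zero by (intro sum.mono_neutral_right) auto
  also have "\<dots> = subspace_trace N f"
    using C assms by (intro subspace_trace_basis[symmetric]) auto
  finally show ?thesis .
qed

lemma uniform_nilpotency:
  assumes "fin_dim U" "subspace U" "endo f" "\<And>v. v \<in> U \<Longrightarrow> \<exists>n. (f ^^ n) v = 0"
  shows "\<exists>n. \<forall>v\<in>U. (f ^^ n) v = 0"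
proof -
  obtain B where B: "finite B" "independent B" "span B = U"
    by (rule fin_dim_basis[OF assms(1,2)])
  then have "\<forall>b\<in>B. \<exists>n. (f ^^ n) b = 0"
    using assms(4) span_base by blast
  then obtain k where k: "\<And>b. b \<in> B \<Longrightarrow> (f ^^ k b) b = 0" by metis
  define n where "n = Max (insert 0 (k ` B))"
  have "(f ^^ n) b \<in> {0}" if "b \<in> B" for b
  proof -
    have "k b \<le> n" unfolding n_def using that B(1) by simp
    then obtain j where "n = j + k b" using le_Suc_ex add.commute by metis
    then show ?thesis using k[OF that] endo_zero[OF endo_funpow[OF assms(3)]] by (simp add: funpow_add)
  qed
  then have "(f ^^ n) v \<in> {0}" if "v \<in> U" for v
    using endo_maps_span[OF endo_funpow[OF assms(3)], where B = B and W = "{0}" and v = v] that B(3) by simp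
  then show ?thesis by blast
qed

text \<open>Replacing \<open>U\<close> by its image under \<open>f\<close> keeps the trace and
  lowers the exponent of nilpotency by one.\<close>

lemma subspace_trace_nilpotent:
  assumes "fin_dim U" "subspace U" "endo f" "f ` U \<subseteq> U" "\<And>v. v \<in> U \<Longrightarrow> \<exists>n. (f ^^ n) v = 0"
  shows "subspace_trace U f = 0"
proof -
  obtain n where "\<And>v. v \<in> U \<Longrightarrow> (f ^^ n) v = 0"
    using uniform_nilpotency[OF assms(1-3,5)] by blast
  with assms(1,2,4) show ?thesis
  proof (induction n arbitrary: U)
    case 0
    then have "v = 0" if "v \<in> U" for v using that by simp
    then have "f v = 0" if "v \<in> U" for v using that endo_zero[OF assms(3)] by blast
    then show ?case using subspace_trace_cong[of U f "\<lambda>v. 0"] 0 subspace_trace_zero by simp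
  next
    case (Suc n)
    have sub: "subspace (f ` U)"
      by (rule endo_image_subspace[OF assms(3) Suc.prems(2)])
    have "subspace_trace U f = subspace_trace (f ` U) f"
      using subspace_trace_range[OF Suc.prems(1,2) sub Suc.prems(3) assms(3)] by simp
    also have "\<dots> = 0"
      using Suc.prems sub fin_dim_subset[OF Suc.prems(1,3)]
      by (intro Suc.IH) (auto simp del: funpow.simps simp: funpow_Suc_right)
    finally show ?case .
  qed
qed

end

section \<open>Generalized eigenspaces\<close>

context linear_space
begin

definition shift :: "('b \<Rightarrow> 'b) \<Rightarrow> 'a \<Rightarrow> 'b \<Rightarrow> 'b" where
  "shift T \<alpha> v = T v - \<alpha> *s v"

lemma endo_shift: "endo T \<Longrightarrow> endo (shift T \<alpha>)"
  by (simp add: endo_iff shift_def scale_right_diff_distrib scale_right_distrib scale_left_commute)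

lemma shift_zero: "shift T 0 = T"
  by (simp add: shift_def fun_eq_iff)

lemma shift_commute: "endo T \<Longrightarrow> shift T \<alpha> (shift T \<beta> v) = shift T \<beta> (shift T \<alpha> v)"
  by (simp add: shift_def endo_diff endo_scale scale_right_diff_distrib scale_left_commute algebra_simps)

lemma shift_funpow_commute: "endo T \<Longrightarrow> (shift T \<alpha> ^^ n) (shift T \<beta> v) = shift T \<beta> ((shift T \<alpha> ^^ n) v)"
  by (induction n) (simp_all add: shift_commute)

definition gen_eigenspace :: "('b \<Rightarrow> 'b) \<Rightarrow> 'a \<Rightarrow> 'b set" where
  "gen_eigenspace T \<alpha> = {v. \<exists>n. (shift T \<alpha> ^^ n) v = 0}"

lemma funpow_eq_zero_mono:
  assumes "endo f" "(f ^^ n) v = 0" "n \<le> m"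
  shows "(f ^^ m) v = 0"
proof -
  obtain k where "m = k + n" using assms(3) le_Suc_ex add.commute by metis
  then show ?thesis using assms(2) endo_zero[OF endo_funpow[OF assms(1)]] by (simp add: funpow_add)
qed

lemma subspace_gen_eigenspace:
  assumes "endo T"
  shows "subspace (gen_eigenspace T \<alpha>)"
proof (rule subspaceI)
  show "0 \<in> gen_eigenspace T \<alpha>"
    unfolding gen_eigenspace_def by (auto intro!: exI[of _ 0])
next
  fix v w assume "v \<in> gen_eigenspace T \<alpha>" "w \<in> gen_eigenspace T \<alpha>"
  then obtain m n where mn: "(shift T \<alpha> ^^ m) v = 0" "(shift T \<alpha> ^^ n) w = 0"
    unfolding gen_eigenspace_def by blast
  have "(shift T \<alpha> ^^ (m + n)) v = 0" "(shift T \<alpha> ^^ (m + n)) w = 0"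
    using funpow_eq_zero_mono[OF endo_shift[OF assms]] mn by auto
  then have "(shift T \<alpha> ^^ (m + n)) (v + w) = 0"
    using endo_add[OF endo_funpow[OF endo_shift[OF assms]]] by simp
  then show "v + w \<in> gen_eigenspace T \<alpha>"
    unfolding gen_eigenspace_def by blast
next
  fix c v assume "v \<in> gen_eigenspace T \<alpha>"
  then show "c *s v \<in> gen_eigenspace T \<alpha>"
    unfolding gen_eigenspace_def using endo_scale[OF endo_funpow[OF endo_shift[OF assms]]] by auto
qed

lemma shift_gen_eigenspace:
  assumes "endo T"
  shows "shift T \<alpha> v \<in> gen_eigenspace T \<alpha> \<longleftrightarrow> v \<in> gen_eigenspace T \<alpha>"
proof
  assume "shift T \<alpha> v \<in> gen_eigenspace T \<alpha>"
  then obtain n where "(shift T \<alpha> ^^ n) (shift T \<alpha> v) = 0" unfolding gen_eigenspace_def by blast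
  then have "(shift T \<alpha> ^^ Suc n) v = 0" by (simp add: funpow_swap1)
  then show "v \<in> gen_eigenspace T \<alpha>" unfolding gen_eigenspace_def by blast
next
  assume "v \<in> gen_eigenspace T \<alpha>"
  then obtain n where "(shift T \<alpha> ^^ n) v = 0" unfolding gen_eigenspace_def by blast
  then have "(shift T \<alpha> ^^ n) (shift T \<alpha> v) = 0"
    using endo_zero[OF endo_shift[OF assms]] by (simp add: shift_funpow_commute[OF assms])
  then show "shift T \<alpha> v \<in> gen_eigenspace T \<alpha>" unfolding gen_eigenspace_def by blast
qed

text \<open>The operators \<open>shift T \<beta>\<close> and \<open>shift T \<alpha>\<close> differ
  by the nonzero scalar \<open>\<alpha> - \<beta>\<close>, so where the latter is nilpotent the
  former is inverted by a finite recursion, which never leaves \<open>J\<close>.\<close>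

lemma shift_surj_on_gen_eigenspace:
  assumes T: "endo T" and J: "subspace J" "\<And>v. v \<in> J \<Longrightarrow> T v \<in> J" and "\<alpha> \<noteq> \<beta>"
    and "v \<in> gen_eigenspace T \<alpha>" "v \<in> J"
  shows "\<exists>u \<in> gen_eigenspace T \<alpha> \<inter> J. shift T \<beta> u = v"
proof -
  have "\<exists>u \<in> gen_eigenspace T \<alpha> \<inter> J. shift T \<beta> u = v" if "(shift T \<alpha> ^^ n) v = 0" "v \<in> J" for n v
    using that
  proof (induction n arbitrary: v)
    case 0
    then show ?case
      using subspace_0[OF J(1)] subspace_0[OF subspace_gen_eigenspace[OF T]]
      by (intro bexI[of _ 0]) (auto simp: shift_def endo_zero[OF T])
  next
    case (Suc n)
    have Jv: "shift T \<alpha> v \<in> J"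
      unfolding shift_def using Suc.prems J by (simp add: subspace_diff subspace_scale)
    have "(shift T \<alpha> ^^ n) (shift T \<alpha> v) = 0"
      using Suc.prems by (simp add: funpow_swap1)
    from Suc.IH[OF this Jv] obtain u where
      u: "u \<in> gen_eigenspace T \<alpha>" "u \<in> J" "shift T \<beta> u = shift T \<alpha> v" by blast
    define w where "w = inverse (\<alpha> - \<beta>) *s (v - u)"
    have "v \<in> gen_eigenspace T \<alpha>" unfolding gen_eigenspace_def using Suc.prems by blast
    then have "w \<in> gen_eigenspace T \<alpha> \<inter> J"
      unfolding w_def using u Suc.prems J(1) subspace_gen_eigenspace[OF T]
      by (simp add: subspace_diff subspace_scale)
    moreover have "shift T \<beta> w = inverse (\<alpha> - \<beta>) *s (shift T \<beta> v - shift T \<beta> u)"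
      unfolding w_def using endo_scale[OF endo_shift[OF T]] endo_diff[OF endo_shift[OF T]] by metis
    then have "shift T \<beta> w = inverse (\<alpha> - \<beta>) *s ((\<alpha> - \<beta>) *s v)"
      unfolding u(3) by (simp add: shift_def scale_left_diff_distrib)
    then have "shift T \<beta> w = v" using assms(4) by simp
    ultimately show ?case by blast
  qed
  then show ?thesis using assms(5,6) unfolding gen_eigenspace_def by blast
qed

text \<open>As \<open>shift T \<beta>\<close> is onto on the pieces for the other eigenvalues, each
  element of the span is \<open>v + shift T \<beta> u\<close> with \<open>v\<close> in the piece for
  \<open>\<beta>\<close> and \<open>u\<close> in the span. For the element
  \<open>shift T \<beta> w\<close> this makes \<open>w - u\<close> a generalized eigenvector for
  \<open>\<beta>\<close>.\<close>

lemma gen_eigenspace_span_shift_closed: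
  assumes T: "endo T" and J: "subspace J" "\<And>v. v \<in> J \<Longrightarrow> T v \<in> J"
    and w: "w \<in> J" "shift T \<beta> w \<in> span (\<Union>\<alpha>. gen_eigenspace T \<alpha> \<inter> J)"
  shows "w \<in> span (\<Union>\<alpha>. gen_eigenspace T \<alpha> \<inter> J)"
proof -
  let ?S = "span (\<Union>\<alpha>. gen_eigenspace T \<alpha> \<inter> J)"
  have sub: "subspace (gen_eigenspace T \<beta> \<inter> J)"
    using subspace_inter subspace_gen_eigenspace[OF T] J(1) by blast
  have SJ: "?S \<subseteq> J" using J(1) by (intro span_minimal) auto
  have "\<exists>v u. v \<in> gen_eigenspace T \<beta> \<inter> J \<and> u \<in> ?S \<and> z = v + shift T \<beta> u" if "z \<in> ?S" for z
    using that
  proof (induction rule: span_induct_alt)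
    case base
    have "0 = 0 + shift T \<beta> 0" by (simp add: shift_def endo_zero[OF T])
    then show ?case using subspace_0[OF sub] span_zero by blast
  next
    case (step c x y)
    then obtain v u where vu: "v \<in> gen_eigenspace T \<beta> \<inter> J" "u \<in> ?S" "y = v + shift T \<beta> u" by blast
    obtain \<alpha> where \<alpha>: "x \<in> gen_eigenspace T \<alpha>" "x \<in> J" using step by blast
    show ?case
    proof (cases "\<alpha> = \<beta>")
      case True
      then have "v + c *s x \<in> gen_eigenspace T \<beta> \<inter> J"
        using \<alpha> vu(1) sub by (meson IntI subspace_add subspace_scale)
      moreover have "c *s x + y = (v + c *s x) + shift T \<beta> u" by (simp add: vu(3))
      ultimately show ?thesis using vu(2) by blast
    next
      case False
      then obtain x' where x': "x' \<in> gen_eigenspace T \<alpha> \<inter> J" "shift T \<beta> x' = x"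
        using shift_surj_on_gen_eigenspace[OF T J False] \<alpha> by blast
      have "c *s x + y = v + shift T \<beta> (u + c *s x')"
        by (simp add: vu(3) x'(2) endo_add[OF endo_shift[OF T]] endo_scale[OF endo_shift[OF T]])
      moreover have "x' \<in> ?S" using x'(1) by (intro span_base) blast
      then have "u + c *s x' \<in> ?S" using vu(2) by (simp add: span_add span_scale)
      ultimately show ?thesis using vu(1) by blast
    qed
  qed
  then obtain v u where vu: "v \<in> gen_eigenspace T \<beta> \<inter> J" "u \<in> ?S" "shift T \<beta> w = v + shift T \<beta> u"
    using w by blast
  have "shift T \<beta> (w - u) \<in> gen_eigenspace T \<beta>"
    using vu by (simp add: endo_diff[OF endo_shift[OF T]])
  then have "w - u \<in> gen_eigenspace T \<beta>"
    using shift_gen_eigenspace[OF T] by blast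
  moreover have "w - u \<in> J" using w vu(2) SJ J(1) by (blast intro: subspace_diff)
  ultimately have "w - u \<in> ?S" by (intro span_base) blast
  then have "(w - u) + u \<in> ?S" using vu(2) span_add by blast
  then show ?thesis by simp
qed

section \<open>Polynomials in an operator\<close>

definition poly_apply :: "('b \<Rightarrow> 'b) \<Rightarrow> 'a poly \<Rightarrow> 'b \<Rightarrow> 'b" where
  "poly_apply T p v = fold_coeffs (\<lambda>a w. a *s v + T w) p 0"

lemma poly_apply_0: "poly_apply T 0 v = 0"
  by (simp add: poly_apply_def)

lemma poly_apply_pCons:
  assumes "endo T"
  shows "poly_apply T (pCons a p) v = a *s v + T (poly_apply T p v)"
  by (cases "a = 0 \<and> p = 0") (auto simp: poly_apply_def endo_zero[OF assms] fold_coeffs_pCons_not_0_0_eq fold_coeffs_pCons_coeff_not_0_eq)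

lemma poly_apply_add:
  assumes "endo T"
  shows "poly_apply T (p + q) v = poly_apply T p v + poly_apply T q v"
  by (induction p q rule: poly_induct2)
    (simp_all add: poly_apply_0 poly_apply_pCons[OF assms] endo_add[OF assms] scale_left_distrib)

lemma poly_apply_smult:
  assumes "endo T"
  shows "poly_apply T (smult c p) v = c *s poly_apply T p v"
  by (induction p)
    (simp_all add: poly_apply_0 poly_apply_pCons[OF assms] endo_scale[OF assms] scale_right_distrib)

lemma poly_apply_linear_factor:
  assumes "endo T"
  shows "poly_apply T ([:- \<beta>, 1:] * q) v = shift T \<beta> (poly_apply T q v)"
proof -
  have "[:- \<beta>, 1:] * q = smult (- \<beta>) q + pCons 0 q" by simp
  then show ?thesis
    by (simp only: poly_apply_add[OF assms] poly_apply_smult[OF assms] poly_apply_pCons[OF assms])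
      (simp add: shift_def)
qed

lemma poly_apply_monom:
  assumes "endo T"
  shows "poly_apply T (monom c n) v = c *s (T ^^ n) v"
proof (induction n)
  case 0
  then show ?case by (simp add: monom_0 poly_apply_pCons[OF assms] poly_apply_0 endo_zero[OF assms])
next
  case (Suc n)
  then show ?case by (simp add: monom_Suc poly_apply_pCons[OF assms] endo_scale[OF assms])
qed

lemma poly_apply_sum:
  assumes "endo T"
  shows "poly_apply T (\<Sum>i\<in>I. p i) v = (\<Sum>i\<in>I. poly_apply T (p i) v)"
  by (induction I rule: infinite_finite_induct) (simp_all add: poly_apply_0 poly_apply_add[OF assms])

lemma poly_apply_in_subspace:
  assumes "endo T" "subspace J" "\<And>v. v \<in> J \<Longrightarrow> T v \<in> J" "v \<in> J"
  shows "poly_apply T p v \<in> J"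
  by (induction p)
    (simp_all add: poly_apply_0 poly_apply_pCons[OF assms(1)] subspace_0 subspace_add subspace_scale assms)

lemma annihilating_poly_exists:
  assumes T: "endo T" and S: "finite S" "\<And>i. (T ^^ i) v \<in> span S"
  shows "\<exists>p. p \<noteq> 0 \<and> poly_apply T p v = 0"
\<comment> \<open>Linear dependence speaks of sets of vectors, so a repetition among the powers is
  treated apart, by a difference of two monomials. Without repetition there are
  \<open>card S + 1\<close> vectors in the span of \<open>S\<close>.\<close>
proof (cases "inj_on (\<lambda>i. (T ^^ i) v) {..card S}")
  case True
  let ?A = "(\<lambda>i. (T ^^ i) v) ` {..card S}"
  have "card ?A = Suc (card S)" using True by (simp add: card_image)
  then have "dependent ?A"
    using independent_span_bound[OF S(1), of ?A] S(2) by fastforce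
  then obtain u w where u: "w \<in> ?A" "u w \<noteq> 0" "(\<Sum>w\<in>?A. u w *s w) = 0"
    using dependent_finite[of ?A] by auto
  define p where "p = (\<Sum>i\<le>card S. monom (u ((T ^^ i) v)) i)"
  have "poly_apply T p v = (\<Sum>i\<le>card S. u ((T ^^ i) v) *s (T ^^ i) v)"
    unfolding p_def by (simp add: poly_apply_sum[OF T] poly_apply_monom[OF T])
  also have "\<dots> = 0" using u(3) True by (simp add: sum.reindex)
  finally have "poly_apply T p v = 0" .
  moreover obtain i where i: "i \<le> card S" "w = (T ^^ i) v" using u(1) by auto
  have "coeff p i = u w"
    unfolding p_def using i by (simp add: coeff_sum)
  then have "p \<noteq> 0" using u(2) by auto
  ultimately show ?thesis by blast
next
  case False
  then obtain i j where ij: "i \<noteq> j" "(T ^^ i) v = (T ^^ j) v" unfolding inj_on_def by blast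
  have "poly_apply T (monom 1 i + monom (- 1) j) v = 0"
    using ij(2) by (simp only: poly_apply_add[OF T] poly_apply_monom[OF T]) simp
  moreover have "coeff (monom 1 i + monom (- 1 :: 'a) j) i = 1" using ij(1) by simp
  then have "monom 1 i + monom (- 1 :: 'a) j \<noteq> 0" by (metis coeff_0 zero_neq_one)
  ultimately show ?thesis by blast
qed

text \<open>Independence of generalized eigenspaces: products of the operators \<open>shift T \<gamma>\<close> with
  \<open>\<gamma> \<noteq> \<alpha>\<close> annihilate the other eigenspaces but are injective on the one for \<open>\<alpha>\<close>.\<close>

lemma gen_eigenspace_disjoint:
  assumes T: "endo T" and v: "v \<in> gen_eigenspace T \<alpha>"
    and "v \<in> span (\<Union>\<gamma>\<in>- {\<alpha>}. gen_eigenspace T \<gamma>)"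
  shows "v = 0"
proof -
  define P where "P L = foldr (\<lambda>\<gamma>. shift T \<gamma>) L" for L
  have P_Cons: "P (\<gamma> # L) u = shift T \<gamma> (P L u)" and P_Nil: "P [] u = u" for \<gamma> L u
    by (simp_all add: P_def)
  have P_append: "P (L @ M) u = P L (P M u)" for L M u by (simp add: P_def)
  have P_endo: "endo (P L)" for L
  proof (induction L)
    case Nil
    then show ?case by (simp add: P_def endo_iff)
  next
    case (Cons \<gamma> L)
    then show ?case using endo_compose[OF endo_shift[OF T]] unfolding P_Cons[abs_def] by simp
  qed
  have P_shift: "P L (shift T \<gamma> u) = shift T \<gamma> (P L u)" for L \<gamma> u
    by (induction L) (simp_all add: P_Nil P_Cons shift_commute[OF T])
  have P_commute: "P L (P M u) = P M (P L u)" for L M u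
    by (induction M) (simp_all add: P_Nil P_Cons P_shift)
  have P_replicate: "P (replicate n \<gamma>) u = (shift T \<gamma> ^^ n) u" for n \<gamma> u
    by (induction n) (simp_all add: P_Nil P_Cons)
  have "\<exists>L. \<alpha> \<notin> set L \<and> P L v = 0"
    using assms(3)
  proof (induction rule: span_induct_alt)
    case base
    show ?case by (intro exI[of _ "[]"]) (simp add: P_Nil)
  next
    case (step c x y)
    then obtain L where L: "\<alpha> \<notin> set L" "P L y = 0" by blast
    obtain \<gamma> n where g: "\<gamma> \<noteq> \<alpha>" "(shift T \<gamma> ^^ n) x = 0"
      using step unfolding gen_eigenspace_def by blast
    have "P (L @ replicate n \<gamma>) x = 0"
      by (simp add: P_append P_replicate g endo_zero[OF P_endo])
    moreover have "P (L @ replicate n \<gamma>) y = 0"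
      by (simp add: P_append P_commute[of L] L endo_zero[OF P_endo])
    ultimately have "P (L @ replicate n \<gamma>) (c *s x + y) = 0"
      using P_endo by (simp add: endo_add endo_scale)
    then show ?case using L(1) g(1) by (intro exI[of _ "L @ replicate n \<gamma>"]) auto
  qed
  then obtain L where L: "\<alpha> \<notin> set L" "P L v = 0" by blast
  \<comment> \<open>On a \<open>u\<close> killed by \<open>shift T \<gamma>\<close>, the operator
    \<open>shift T \<alpha>\<close> is the nonzero scalar \<open>\<gamma> - \<alpha>\<close>, so no
    power of it can kill \<open>u\<close> unless \<open>u = 0\<close>.\<close>
  have inj: "u = 0" if "shift T \<gamma> u = 0" "\<gamma> \<noteq> \<alpha>" "u \<in> gen_eigenspace T \<alpha>" for \<gamma> u
  proof -
    have "shift T \<alpha> u = (\<gamma> - \<alpha>) *s u"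
      using that(1) by (simp add: shift_def scale_left_diff_distrib)
    then have "(shift T \<alpha> ^^ n) u = (\<gamma> - \<alpha>) ^ n *s u" for n
      by (induction n) (simp_all add: endo_scale[OF endo_shift[OF T]] mult.commute)
    then show ?thesis using that unfolding gen_eigenspace_def by auto
  qed
  have stable: "shift T \<gamma> u \<in> gen_eigenspace T \<alpha>" if "u \<in> gen_eigenspace T \<alpha>" for \<gamma> u
    using that endo_zero[OF endo_shift[OF T]]
    unfolding gen_eigenspace_def mem_Collect_eq shift_funpow_commute[OF T] by metis
  have Pst: "P L u \<in> gen_eigenspace T \<alpha>" if "u \<in> gen_eigenspace T \<alpha>" for u L
    using that by (induction L) (simp_all add: P_Nil P_Cons stable)
  show ?thesis
    using L
  proof (induction L)
    case Nil
    then show ?case by (simp add: P_Nil)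
  next
    case (Cons \<gamma> L)
    then show ?case using inj[of \<gamma> "P L v"] Pst[OF v] by (auto simp: P_Cons)
  qed
qed

text \<open>Prescribed on a basis of generalized eigenvectors. With \<open>g\<close> the identity
  this is the semisimple part of \<open>T\<close>; with \<open>g = cnj\<close> it is the conjugate
  of that part.\<close>

lemma semisimple_operator_exists:
  assumes T: "endo T" and full: "span (\<Union>\<alpha>. gen_eigenspace T \<alpha>) = UNIV"
  shows "\<exists>S. endo S \<and> (\<forall>\<alpha>. \<forall>v\<in>gen_eigenspace T \<alpha>. S v = g \<alpha> *s v)"
proof -
  interpret pair: vector_space_pair scale scale ..
  obtain B where B: "B \<subseteq> (\<Union>\<alpha>. gen_eigenspace T \<alpha>)" "independent B" "(\<Union>\<alpha>. gen_eigenspace T \<alpha>) \<subseteq> span B"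
    by (rule maximal_independent_subset)
  have "span B = UNIV" using B(3) full span_minimal[OF B(3)] by auto
  obtain ev where ev: "\<And>b. b \<in> B \<Longrightarrow> b \<in> gen_eigenspace T (ev b)" using B(1) by (metis UN_E subsetD)
  define S where "S = pair.construct B (\<lambda>b. g (ev b) *s b)"
  have S: "endo S" unfolding S_def by (rule pair.linear_construct[OF B(2)])
  have Sb: "S b = g (ev b) *s b" if "b \<in> B" for b
    unfolding S_def by (rule pair.construct_basis[OF B(2) that])
  have "S v = g \<alpha> *s v" if v: "v \<in> gen_eigenspace T \<alpha>" for \<alpha> v
  proof -
    let ?G = "\<lambda>\<alpha>. gen_eigenspace T \<alpha>"
    \<comment> \<open>Basis vectors are sorted by whether their eigenvalue is
      \<open>\<alpha>\<close>. For \<open>v\<close> in that eigenspace, the remainder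
      \<open>w2\<close> lies both in it and in the span of the others, so it vanishes.\<close>
    have "\<exists>w1 w2. w1 \<in> ?G \<alpha> \<and> S w1 = g \<alpha> *s w1 \<and> w2 \<in> span (\<Union>\<gamma>\<in>- {\<alpha>}. ?G \<gamma>) \<and> z = w1 + w2"
      if "z \<in> span B" for z
      using that
    proof (induction rule: span_induct_alt)
      case base
      show ?case
        using subspace_0[OF subspace_gen_eigenspace[OF T]] span_zero
        by (intro exI[of _ 0]) (auto simp: endo_zero[OF S])
    next
      case (step c x y)
      then obtain w1 w2 where w: "w1 \<in> ?G \<alpha>" "S w1 = g \<alpha> *s w1" "w2 \<in> span (\<Union>\<gamma>\<in>- {\<alpha>}. ?G \<gamma>)" "y = w1 + w2"
        by blast
      show ?case
      proof (cases "ev x = \<alpha>")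
        case True
        have "c *s x + w1 \<in> ?G \<alpha>"
          using w(1) ev[OF step(1)] True subspace_gen_eigenspace[OF T] by (metis subspace_add subspace_scale)
        moreover have "S (c *s x + w1) = g \<alpha> *s (c *s x + w1)"
          using Sb[OF step(1)] True w(2) S
          by (simp add: endo_add endo_scale scale_right_distrib mult.commute)
        ultimately show ?thesis using w(3,4) by (metis add.assoc)
      next
        case False
        have "x \<in> span (\<Union>\<gamma>\<in>- {\<alpha>}. ?G \<gamma>)" using False ev[OF step(1)] by (intro span_base) blast
        then have "c *s x + w2 \<in> span (\<Union>\<gamma>\<in>- {\<alpha>}. ?G \<gamma>)" using w(3) by (simp add: span_add span_scale)
        then show ?thesis using w(1,2,4) by (metis add.left_commute)
      qed
    qed
    then obtain w1 w2 where w: "w1 \<in> ?G \<alpha>" "S w1 = g \<alpha> *s w1"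
      "w2 \<in> span (\<Union>\<gamma>\<in>- {\<alpha>}. ?G \<gamma>)" "v = w1 + w2"
      using \<open>span B = UNIV\<close> by blast
    have "v - w1 \<in> ?G \<alpha>"
      using v w(1) subspace_gen_eigenspace[OF T] by (simp add: subspace_diff)
    then have "w2 = 0" using gen_eigenspace_disjoint[OF T, of w2] w by simp
    then show ?thesis using w by simp
  qed
  then show ?thesis using S by blast
qed

end

locale complex_linear_space = linear_space scale
  for scale :: "complex \<Rightarrow> 'b::ab_group_add \<Rightarrow> 'b" (infixr \<open>*s\<close> 75)
begin

text \<open>A root of a polynomial annihilating \<open>v\<close> splits off a linear factor, which
  can be cancelled by \<open>gen_eigenspace_span_shift_closed\<close>; after finitely many
  cancellations a nonzero constant is left. Finiteness is asked only of the orbit of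
  \<open>v\<close>.\<close>

lemma in_span_gen_eigenspaces:
  assumes T: "endo T" and J: "subspace J" "\<And>v. v \<in> J \<Longrightarrow> T v \<in> J"
    and v: "v \<in> J" and S: "finite S" "\<And>i. (T ^^ i) v \<in> span S"
  shows "v \<in> span (\<Union>\<alpha>. gen_eigenspace T \<alpha> \<inter> J)"
proof -
  let ?S = "span (\<Union>\<alpha>. gen_eigenspace T \<alpha> \<inter> J)"
  \<comment> \<open>Weakening \<open>poly_apply T p v = 0\<close> to membership in the span is what
    survives the removal of a factor.\<close>
  have "v \<in> ?S" if "p \<noteq> 0" "poly_apply T p v \<in> ?S" for p
    using that
  proof (induction "degree p" arbitrary: p)
    case 0
    then obtain c where c: "p = [:c:]" "c \<noteq> 0" by (metis degree_eq_zeroE pCons_0_0)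
    then have "c *s v \<in> ?S" using 0 by (simp add: poly_apply_pCons[OF T] poly_apply_0 endo_zero[OF T])
    then have "inverse c *s (c *s v) \<in> ?S" by (rule span_scale)
    then show ?case using c by simp
  next
    case (Suc n)
    then have "\<not> constant (poly p)" by (simp add: constant_degree)
    then obtain \<beta> where "poly p \<beta> = 0" using fundamental_theorem_of_algebra by blast
    then obtain q where q: "p = [:- \<beta>, 1:] * q" by (metis poly_eq_0_iff_dvd dvdE)
    then have q0: "q \<noteq> 0" using Suc by auto
    have "degree p = Suc (degree q)" unfolding q using q0 by (subst degree_mult_eq) auto
    moreover have "poly_apply T q v \<in> ?S"
      using gen_eigenspace_span_shift_closed[OF T J poly_apply_in_subspace[OF T J v]]
        Suc.prems(2) unfolding q poly_apply_linear_factor[OF T] by blast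
    ultimately show ?case using Suc.hyps q0 by simp
  qed
  moreover obtain p where "p \<noteq> 0" "poly_apply T p v = 0"
    using annihilating_poly_exists[OF T S] by blast
  ultimately show ?thesis using span_zero by metis
qed

end

section \<open>Perfect Lie algebras of complex operators\<close>

context complex_linear_space
begin

abbreviation (input) opscale :: "complex \<Rightarrow> ('b \<Rightarrow> 'b) \<Rightarrow> 'b \<Rightarrow> 'b" where
  "opscale c f \<equiv> \<lambda>v. c *s f v"

text \<open>Operators are vectors too, so the eigenspace lemmas apply a second time, to
  \<open>ad x\<close> acting on operators.\<close>

lemma complex_linear_space_opscale: "complex_linear_space opscale"
  by unfold_locales (simp_all add: fun_eq_iff scale_right_distrib scale_left_distrib)

text \<open>The Leibniz rule \<open>key\<close> splits one factor
  \<open>shift x (\<alpha> + \<beta>)\<close> on \<open>a v\<close> into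
  \<open>shift ad \<beta>\<close> on \<open>a\<close> and \<open>shift x \<alpha>\<close> on
  \<open>v\<close>. If \<open>m\<close> factors kill \<open>a\<close> and \<open>n\<close> kill
  \<open>v\<close>, then \<open>m + n\<close> factors kill \<open>a v\<close>.\<close>

lemma op_shift_gen_eigenspace:
  fixes x :: "'b \<Rightarrow> 'b"
  defines "ad \<equiv> \<lambda>f v. x (f v) - f (x v)"
  assumes x: "endo x" and a: "endo a" "a \<in> linear_space.gen_eigenspace opscale ad \<beta>"
    and v: "v \<in> gen_eigenspace x \<alpha>"
  shows "a v \<in> gen_eigenspace x (\<alpha> + \<beta>)"
proof -
  interpret F: complex_linear_space opscale by (rule complex_linear_space_opscale)
  have key: "shift x (\<alpha> + \<beta>) (a v) = F.shift ad \<beta> a v + a (shift x \<alpha> v)" if "endo a" for a v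
    using that
    by (simp add: shift_def F.shift_def ad_def endo_diff endo_scale scale_left_distrib fun_diff_def)
  have endo_ad: "endo (F.shift ad \<beta> a)" if "endo a" for a
    using that x unfolding F.shift_def ad_def fun_diff_def endo_iff
    by (simp add: algebra_simps scale_right_distrib scale_right_diff_distrib mult.commute)
  have "(shift x (\<alpha> + \<beta>) ^^ k) (a v) = 0"
    if "k = m + n" "endo a" "(F.shift ad \<beta> ^^ m) a = 0" "(shift x \<alpha> ^^ n) v = 0" for k m n a v
    using that
  proof (induction k arbitrary: m n a v)
    case 0
    then show ?case by simp
  next
    case (Suc k)
    have E: "endo (shift x (\<alpha> + \<beta>) ^^ i)" for i by (intro endo_funpow endo_shift x)
    show ?case
    proof (cases "m = 0 \<or> n = 0")
      case True
      then have "a v = 0" using Suc.prems by (auto simp: endo_zero)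
      then show ?thesis using endo_zero[OF E] by metis
    next
      case False
      then obtain m' n' where mn: "m = Suc m'" "n = Suc n'" by (metis not0_implies_Suc)
      have "(shift x (\<alpha> + \<beta>) ^^ k) (F.shift ad \<beta> a v) = 0"
        using Suc.prems mn by (intro Suc.IH[of m' n] endo_ad) (simp_all add: funpow_swap1)
      moreover have "(shift x (\<alpha> + \<beta>) ^^ k) (a (shift x \<alpha> v)) = 0"
        using Suc.prems mn by (intro Suc.IH[of m n']) (simp_all add: funpow_swap1)
      ultimately have "(shift x (\<alpha> + \<beta>) ^^ k) (shift x (\<alpha> + \<beta>) (a v)) = 0"
        using endo_add[OF E] key[OF Suc.prems(2)] by simp
      then show ?thesis by (simp add: funpow_swap1)
    qed
  qed
  then show ?thesis using a v unfolding F.gen_eigenspace_def gen_eigenspace_def by blast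
qed

lemma endo_eqI:
  assumes "endo f" "endo g" "span B = UNIV" "\<And>b. b \<in> B \<Longrightarrow> f b = g b"
  shows "f v = g v"
proof -
  have "endo (\<lambda>v. f v - g v)"
    using assms(1,2) by (simp add: endo_iff scale_right_diff_distrib)
  then have "f v - g v \<in> {0}"
    using endo_maps_span[of "\<lambda>v. f v - g v" B "{0}" v] assms(3,4) by simp
  then show ?thesis by simp
qed

text \<open>Both \<open>S\<close> and the trace live on \<open>W\<close>, the sum of the eigenspaces
  for nonzero eigenvalues. With \<open>D\<close> the semisimple part of \<open>x\<close>,
  \<open>S (x - D)\<close> is nilpotent and \<open>S D\<close> is diagonal with entries
  \<open>cnj \<alpha> * \<alpha>\<close>. If these sum to zero, only the eigenvalue 0
  occurs.\<close>

lemma trace_cnj_semisimple_part: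
  assumes V: "subspace V" "fin_dim V" and x: "endo x" "range x \<subseteq> V"
    and full: "span (\<Union>\<alpha>. gen_eigenspace x \<alpha>) = UNIV"
    and S: "endo S" "\<And>\<alpha> v. v \<in> gen_eigenspace x \<alpha> \<Longrightarrow> S v = cnj \<alpha> *s v"
  shows "range S \<subseteq> V"
    and "subspace_trace V (\<lambda>v. S (x v)) = 0 \<Longrightarrow> \<exists>n. (x ^^ n) v = 0"
proof -
  \<comment> \<open>Here \<open>\<alpha> *s v\<close> is \<open>x v - shift x \<alpha> v\<close>:
    the first term lies in the range of \<open>x\<close>, the second in \<open>V\<close> by
    induction.\<close>
  have inV: "v \<in> V" if "v \<in> gen_eigenspace x \<alpha>" "\<alpha> \<noteq> 0" for v \<alpha>
  proof -
    have "v \<in> V" if "(shift x \<alpha> ^^ n) v = 0" for n v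
      using that
    proof (induction n arbitrary: v)
      case 0
      then show ?case using subspace_0[OF V(1)] by simp
    next
      case (Suc n)
      then have "shift x \<alpha> v \<in> V" by (simp add: funpow_swap1)
      then have "x v - shift x \<alpha> v \<in> V" using x(2) V(1) by (intro subspace_diff) auto
      then have "\<alpha> *s v \<in> V" by (simp add: shift_def)
      then have "inverse \<alpha> *s (\<alpha> *s v) \<in> V" by (rule subspace_scale[OF V(1)])
      then show ?case using \<open>\<alpha> \<noteq> 0\<close> by simp
    qed
    then show ?thesis using that(1) unfolding gen_eigenspace_def by blast
  qed
  obtain B where B: "B \<subseteq> (\<Union>\<alpha>\<in>- {0}. gen_eigenspace x \<alpha>)" "independent B"
    "(\<Union>\<alpha>\<in>- {0}. gen_eigenspace x \<alpha>) \<subseteq> span B"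
    by (rule maximal_independent_subset)
  define W where "W = span B"
  have W: "subspace W" unfolding W_def by simp
  have BV: "B \<subseteq> V" using B(1) inV by blast
  then have WV: "W \<subseteq> V" unfolding W_def using V(1) by (rule span_minimal)
  have finB: "finite B" using fin_dim_independent_finite[OF V(2) B(2) BV] .
  have finW: "fin_dim W" using fin_dim_subset[OF V(2) WV] .
  have SW: "S v \<in> W" for v
  proof (rule endo_maps_span[OF S(1)])
    show "v \<in> span (\<Union>\<alpha>. gen_eigenspace x \<alpha>)" using full by simp
    fix b assume "b \<in> (\<Union>\<alpha>. gen_eigenspace x \<alpha>)"
    then obtain \<alpha> where b: "b \<in> gen_eigenspace x \<alpha>" by blast
    show "S b \<in> W"
    proof (cases "\<alpha> = 0")
      case True
      then show ?thesis using S(2)[OF b] subspace_0[OF W] by simp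
    next
      case False
      then have "b \<in> W" unfolding W_def using b B(3) by blast
      then show ?thesis using S(2)[OF b] subspace_scale[OF W] by simp
    qed
  qed (rule W)
  then show "range S \<subseteq> V" using WV by blast
  assume tr: "subspace_trace V (\<lambda>v. S (x v)) = 0"
  obtain D where D: "endo D" "\<And>\<alpha> v. v \<in> gen_eigenspace x \<alpha> \<Longrightarrow> D v = \<alpha> *s v"
    using semisimple_operator_exists[OF x(1) full, of "\<lambda>\<alpha>. \<alpha>"] by blast
  \<comment> \<open>On the eigenspace for \<open>\<alpha>\<close> this operator is
    \<open>cnj \<alpha>\<close> times \<open>shift x \<alpha>\<close>, hence locally
    nilpotent.\<close>
  let ?F = "\<lambda>v. S (x v - D v)"
  have F: "endo ?F"
    using S(1) x(1) D(1) by (simp add: endo_iff endo_diff scale_right_diff_distrib algebra_simps)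
  have Fpow: "(?F ^^ n) v = cnj \<alpha> ^ n *s (shift x \<alpha> ^^ n) v" if "v \<in> gen_eigenspace x \<alpha>" for n v \<alpha>
    using that
  proof (induction n arbitrary: v)
    case 0
    then show ?case by simp
  next
    case (Suc n)
    have sv: "shift x \<alpha> v \<in> gen_eigenspace x \<alpha>"
      using Suc.prems shift_gen_eigenspace[OF x(1)] by blast
    have Fv: "?F v = cnj \<alpha> *s shift x \<alpha> v"
      using S(2)[OF sv] D(2)[OF Suc.prems] by (simp add: shift_def)
    have "(?F ^^ Suc n) v = (?F ^^ n) (cnj \<alpha> *s shift x \<alpha> v)"
      unfolding Fv[symmetric] funpow_Suc_right by simp
    also have "\<dots> = cnj \<alpha> *s (cnj \<alpha> ^ n *s (shift x \<alpha> ^^ n) (shift x \<alpha> v))"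
      using Suc.IH[OF sv] endo_scale[OF endo_funpow[OF F]] by simp
    finally show ?case by (simp add: funpow_swap1)
  qed
  have nilF: "v \<in> gen_eigenspace ?F 0" for v
  proof -
    have "(\<Union>\<alpha>. gen_eigenspace x \<alpha>) \<subseteq> gen_eigenspace ?F 0"
    proof
      fix v assume "v \<in> (\<Union>\<alpha>. gen_eigenspace x \<alpha>)"
      then obtain \<alpha> n where v: "v \<in> gen_eigenspace x \<alpha>" "(shift x \<alpha> ^^ n) v = 0"
        unfolding gen_eigenspace_def by blast
      then have "(?F ^^ n) v = 0" using Fpow[OF v(1)] by simp
      then show "v \<in> gen_eigenspace ?F 0" unfolding gen_eigenspace_def shift_zero by blast
    qed
    then show ?thesis using full span_minimal[OF _ subspace_gen_eigenspace[OF F, of 0]] by blast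
  qed
  then have trF: "subspace_trace W ?F = 0"
    using SW by (intro subspace_trace_nilpotent[OF finW W F]) (auto simp: gen_eigenspace_def shift_zero)
  have ev: "\<forall>b\<in>B. \<exists>\<alpha>. \<alpha> \<noteq> 0 \<and> b \<in> gen_eigenspace x \<alpha>" using B(1) by blast
  then obtain ev where ev: "\<And>b. b \<in> B \<Longrightarrow> ev b \<noteq> 0 \<and> b \<in> gen_eigenspace x (ev b)" by metis
  have "endo (\<lambda>v. S (x v))" by (rule endo_compose[OF S(1) x(1)])
  then have "subspace_trace V (\<lambda>v. S (x v)) = subspace_trace W (\<lambda>v. S (x v))"
    using SW WV by (intro subspace_trace_range[OF V(2,1) W]) auto
  also have "\<dots> = subspace_trace W (\<lambda>v. ?F v + S (D v))"
    using S(1) by (simp add: endo_diff)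
  also have "\<dots> = subspace_trace W (\<lambda>v. S (D v))"
    using trF by (simp add: subspace_trace_add[OF W])
  also have "\<dots> = (\<Sum>b\<in>B. representation B (S (D b)) b)"
    using SW by (intro subspace_trace_basis[OF finB B(2)] endo_compose[OF S(1) D(1)]) (auto simp: W_def)
  also have "\<dots> = (\<Sum>b\<in>B. complex_of_real ((cmod (ev b))\<^sup>2))"
  proof (rule sum.cong[OF refl])
    fix b assume b: "b \<in> B"
    have "S (D b) = (cnj (ev b) * ev b) *s b"
      using D(2) S(2) ev[OF b] endo_scale[OF S(1)] by (metis mult.commute scale_scale)
    then show "representation B (S (D b)) b = complex_of_real ((cmod (ev b))\<^sup>2)"
      using b B(2) by (simp add: representation_scale span_base representation_basis)
        (metis complex_norm_square mult.commute of_real_power)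
  qed
  finally have "(\<Sum>b\<in>B. (cmod (ev b))\<^sup>2) = 0"
    using tr by (metis of_real_sum of_real_eq_0_iff)
  then have "\<forall>b\<in>B. (cmod (ev b))\<^sup>2 = 0"
    using finB by (subst (asm) sum_nonneg_eq_0_iff) auto
  then have "B = {}" using ev by auto
  then have "gen_eigenspace x \<alpha> \<subseteq> gen_eigenspace x 0" for \<alpha>
    using B(3) subspace_0[OF subspace_gen_eigenspace[OF x(1)]] by (cases "\<alpha> = 0") auto
  then have "(\<Union>\<alpha>. gen_eigenspace x \<alpha>) \<subseteq> gen_eigenspace x 0" by blast
  from span_minimal[OF this subspace_gen_eigenspace[OF x(1)]]
  have "v \<in> gen_eigenspace x 0" using full by blast
  then show "\<exists>n. (x ^^ n) v = 0" unfolding gen_eigenspace_def shift_zero by blast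
qed

text \<open>Key point: if \<open>S\<close> is the complex conjugate of the semisimple part of \<open>x\<close>, then \<open>ad S\<close>
  multiplies each generalized eigenspace of \<open>ad x\<close> by the conjugate eigenvalue, hence preserves \<open>J\<close>.
  So \<open>tr (S [a,b]) = tr ([S,a] b) = 0\<close>, while \<open>tr (S x)\<close> is a sum of squared moduli.\<close>

lemma trace_form_zero_imp_nilpotent:
  assumes V: "subspace V" "fin_dim V"
    and J: "module.subspace opscale J" "linear_space.fin_dim opscale J"
    and Jop: "\<And>a. a \<in> J \<Longrightarrow> endo a" "\<And>a. a \<in> J \<Longrightarrow> range a \<subseteq> V"
    and closed: "\<And>a b. a \<in> J \<Longrightarrow> b \<in> J \<Longrightarrow> (\<lambda>v. a (b v) - b (a v)) \<in> J"
    and perfect: "J \<subseteq> module.span opscale {\<lambda>v. a (b v) - b (a v) | a b. a \<in> J \<and> b \<in> J}"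
    and tr0: "\<And>a b. a \<in> J \<Longrightarrow> b \<in> J \<Longrightarrow> subspace_trace V (\<lambda>v. a (b v)) = 0"
    and x: "x \<in> J"
  shows "\<exists>n. (x ^^ n) v = 0"
proof -
  interpret F: complex_linear_space opscale by (rule complex_linear_space_opscale)
  define ad where "ad = (\<lambda>f v. x (f v) - f (x v))"
  note ex = Jop(1)[OF x]
  have ead: "F.endo ad"
    unfolding F.endo_iff ad_def using ex by (auto simp: fun_eq_iff endo_add endo_scale scale_right_diff_distrib)
  obtain BV where BV: "finite BV" "V \<subseteq> span BV" using V(2) unfolding fin_dim_def by blast
  have "v \<in> span (\<Union>\<alpha>. gen_eigenspace x \<alpha> \<inter> UNIV)" for v
  proof (rule in_span_gen_eigenspaces[OF ex])
    show "finite (insert v BV)" using BV(1) by simp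
    show "(x ^^ i) v \<in> span (insert v BV)" for i
    proof (cases i)
      case 0
      then show ?thesis by (simp add: span_base)
    next
      case (Suc j)
      then have "(x ^^ i) v \<in> V" using Jop(2)[OF x] by auto
      then show ?thesis using BV(2) span_mono[of BV "insert v BV"] by blast
    qed
  qed simp_all
  then have full: "span (\<Union>\<alpha>. gen_eigenspace x \<alpha>) = UNIV" by auto
  obtain S where S: "endo S" "\<And>\<alpha> v. v \<in> gen_eigenspace x \<alpha> \<Longrightarrow> S v = cnj \<alpha> *s v"
    using semisimple_operator_exists[OF ex full, of cnj] by blast
  have SV: "range S \<subseteq> V"
    using trace_cnj_semisimple_part(1)[OF V ex Jop(2)[OF x] full S] .
  have SJ: "(\<lambda>v. S (a v) - a (S v)) \<in> J" if a: "a \<in> J" for a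
  proof -
    obtain BJ where BJ: "finite BJ" "J \<subseteq> F.span BJ" using J(2) unfolding F.fin_dim_def by blast
    have adJ: "ad f \<in> J" if "f \<in> J" for f
      unfolding ad_def using closed[OF x that] .
    have "(ad ^^ i) a \<in> J" for i by (induction i) (simp_all add: a adJ)
    \<comment> \<open>The decomposition takes place inside \<open>J\<close>: each eigencomponent
      belongs to \<open>J\<close>, so rescaling it by \<open>cnj \<beta>\<close> stays in
      \<open>J\<close>.\<close>
    then have "a \<in> F.span (\<Union>\<beta>. F.gen_eigenspace ad \<beta> \<inter> J)"
      using F.in_span_gen_eigenspaces[OF ead J(1) adJ a BJ(1)] BJ(2) by blast
    then show ?thesis
    proof (induction rule: F.span_induct_alt)
      case base
      have "(\<lambda>v. S ((0 :: 'b \<Rightarrow> 'b) v) - (0 :: 'b \<Rightarrow> 'b) (S v)) = 0"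
        by (simp add: fun_eq_iff endo_zero[OF S(1)])
      then show ?case using F.subspace_0[OF J(1)] by simp
    next
      case (step c a b)
      then obtain \<beta> where a: "a \<in> F.gen_eigenspace ad \<beta>" "a \<in> J" by blast
      note ea = Jop(1)[OF a(2)]
      have "S (a v) - a (S v) = cnj \<beta> *s a v" for v
      proof (rule endo_eqI[where f = "\<lambda>v. S (a v) - a (S v)" and g = "\<lambda>v. cnj \<beta> *s a v", OF _ _ full])
        show "endo (\<lambda>v. S (a v) - a (S v))" "endo (\<lambda>v. cnj \<beta> *s a v)"
          using S(1) ea by (simp_all add: endo_iff scale_right_diff_distrib scale_right_distrib mult.commute)
        fix v assume "v \<in> (\<Union>\<alpha>. gen_eigenspace x \<alpha>)"
        then obtain \<alpha> where v: "v \<in> gen_eigenspace x \<alpha>" by blast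
        have "a v \<in> gen_eigenspace x (\<alpha> + \<beta>)"
          using op_shift_gen_eigenspace[OF ex ea _ v] a(1) unfolding ad_def by blast
        then show "S (a v) - a (S v) = cnj \<beta> *s a v"
          using S(2)[OF v] S(2)[of "a v"] ea by (simp add: endo_scale scale_left_distrib)
      qed
      then have "(\<lambda>v. S (a v) - a (S v)) = opscale (cnj \<beta>) a" by simp
      then have "(\<lambda>v. S (a v) - a (S v)) \<in> J" using F.subspace_scale[OF J(1) a(2)] by simp
      then have "opscale c (\<lambda>v. S (a v) - a (S v)) + (\<lambda>v. S (b v) - b (S v)) \<in> J"
        using step F.subspace_add[OF J(1)] F.subspace_scale[OF J(1)] by blast
      moreover have "opscale c (\<lambda>v. S (a v) - a (S v)) + (\<lambda>v. S (b v) - b (S v)) =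
        (\<lambda>v. S ((opscale c a + b) v) - (opscale c a + b) (S v))"
        by (simp add: fun_eq_iff endo_add[OF S(1)] endo_scale[OF S(1)] scale_right_diff_distrib)
      ultimately show ?case by simp
    qed
  qed
  have "subspace_trace V (\<lambda>v. S (z v)) = 0" if "z \<in> J" for z
  proof -
    have "z \<in> F.span {\<lambda>v. a (b v) - b (a v) | a b. a \<in> J \<and> b \<in> J}" using perfect that by blast
    then show ?thesis
    proof (induction rule: F.span_induct_alt)
      case base
      then show ?case by (simp add: endo_zero[OF S(1)] subspace_trace_zero[OF V(1)])
    next
      case (step c z y)
      then obtain a b where ab: "a \<in> J" "b \<in> J" "z = (\<lambda>v. a (b v) - b (a v))" by blast
      have "subspace_trace V (\<lambda>v. S (b (a v))) = subspace_trace V (\<lambda>v. a (S (b v)))"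
        using SV Jop(2)[OF ab(1)]
        by (intro subspace_trace_commute[OF V(2,1) endo_compose[OF S(1) Jop(1)[OF ab(2)]] _ Jop(1)[OF ab(1)]]) auto
      then have "subspace_trace V (\<lambda>v. S (z v)) = subspace_trace V (\<lambda>v. S (a (b v)) - a (S (b v)))"
        unfolding ab(3) by (simp add: endo_diff[OF S(1)] subspace_trace_diff[OF V(1)])
      also have "\<dots> = 0" using tr0[OF SJ[OF ab(1)] ab(2)] .
      finally show ?case
        using step.IH
        by (simp add: endo_add[OF S(1)] endo_scale[OF S(1)] subspace_trace_add[OF V(1)])
    qed
  qed
  then show ?thesis
    using trace_cnj_semisimple_part(2)[OF V ex Jop(2)[OF x] full S] x by blast
qed

end

section \<open>Complexification of the adjoint action\<close>

lemma (in module) span_induct_alt_strong [consumes 1, case_names base step]: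
  assumes "x \<in> span S" "P 0"
    and "\<And>c x y. x \<in> S \<Longrightarrow> y \<in> span S \<Longrightarrow> P y \<Longrightarrow> P (scale c x + y)"
  shows "P x"
proof -
  have "x \<in> span S \<and> P x"
    using assms(1)
    by (induction rule: span_induct_alt) (use assms in \<open>auto intro: span_zero span_add span_scale span_base\<close>)
  then show ?thesis ..
qed

lemma sum_fun_apply: "(\<Sum>i\<in>I. f i) x = (\<Sum>i\<in>I. f i x)"
  for f :: "'i \<Rightarrow> 'c \<Rightarrow> 'd::comm_monoid_add"
  by (induction I rule: infinite_finite_induct) simp_all

text \<open>The embedding of the scalars into \<open>complex\<close> covers the real and the complex case at once.\<close>

locale lie_algebra_in_complex = finite_dim_lie_algebra scale bracket
  for scale :: "'k::field \<Rightarrow> 'a::ab_group_add \<Rightarrow> 'a" (infixr \<open>*s\<close> 75) and bracket +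
  fixes embed :: "'k \<Rightarrow> complex"
  assumes embed_add: "embed (c + d) = embed c + embed d"
    and embed_mult: "embed (c * d) = embed c * embed d"
    and embed_one: "embed 1 = 1"
begin

sublocale linear_space scale ..

lemma embed_zero: "embed 0 = 0"
  using embed_add[of 0 0] by simp

lemma embed_sum: "embed (\<Sum>i\<in>I. f i) = (\<Sum>i\<in>I. embed (f i))"
  by (induction I rule: infinite_finite_induct) (simp_all add: embed_zero embed_add)

lemma embed_eq_0_iff: "embed c = 0 \<longleftrightarrow> c = 0"
proof
  assume "embed c = 0"
  then have "c * inverse c \<noteq> 1" using embed_mult[of c "inverse c"] embed_one by auto
  then show "c = 0" by (cases "c = 0") simp_all
qed (simp add: embed_zero)

lemma embed_of_nat: "embed (of_nat n) = of_nat n"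
  by (induction n) (simp_all add: embed_zero embed_add embed_one)

text \<open>Characteristic zero, inherited from \<open>complex\<close>. It is needed for 2 and for
  the trace of the Casimir operator.\<close>

lemma of_nat_nonzero: "n \<noteq> 0 \<Longrightarrow> (of_nat n :: 'k) \<noteq> 0"
  using embed_of_nat[of n] embed_zero by fastforce

lemma fin_dim_all: "fin_dim U"
  using finite_dim unfolding fin_dim_def by blast

lemma endo_bracket: "endo (bracket x)"
  by (simp add: endo_iff bracket_add_right bracket_scale_right)

lemma bracket_anticommute: "bracket x y = - bracket y x"
proof -
  have "bracket (x + y) (x + y) = 0" by (rule bracket_self)
  then have "bracket x y + bracket y x = 0"
    unfolding bracket_add_left bracket_add_right by (simp add: bracket_self add.commute)
  then show ?thesis by (simp add: eq_neg_iff_add_eq_0)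
qed

lemma endo_bracket_left: "endo (\<lambda>x. bracket x y)"
  by (simp add: endo_iff bracket_add_left bracket_scale_left)

lemmas bracket_simps =
  endo_zero[OF endo_bracket] endo_neg[OF endo_bracket] endo_diff[OF endo_bracket] bracket_add_right
  endo_sum[OF endo_bracket] bracket_scale_right
  endo_zero[OF endo_bracket_left] endo_neg[OF endo_bracket_left] endo_diff[OF endo_bracket_left]
  bracket_add_left endo_sum[OF endo_bracket_left] bracket_scale_left

lemma bracket_bracket: "bracket (bracket x y) z = bracket x (bracket y z) - bracket y (bracket x z)"
proof -
  have "bracket y (bracket z x) = - bracket y (bracket x z)"
    using bracket_anticommute[of z x] by (simp add: bracket_simps)
  then show ?thesis
    using jacobi[of x y z] bracket_anticommute[of z "bracket x y"] by (simp add: algebra_simps)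
qed

text \<open>Transfer from complex operators. A basis of \<open>U\<close> turns vectors into complex
  coordinate functions and \<open>J\<close> into a set of operators whose complex span
  \<open>JC\<close> is still perfect with vanishing trace form. As \<open>embed\<close> is
  injective, so is \<open>cvec\<close> on \<open>U\<close>, and nilpotency comes back.\<close>

lemma trace_form_zero_imp_ad_nilpotent:
  assumes J: "subspace J" "\<And>a b. a \<in> J \<Longrightarrow> b \<in> J \<Longrightarrow> bracket a b \<in> J"
      "J \<subseteq> span {bracket a b | a b. a \<in> J \<and> b \<in> J}"
    and U: "subspace U" "\<And>a u. a \<in> J \<Longrightarrow> u \<in> U \<Longrightarrow> bracket a u \<in> U"
    and tr0: "\<And>a b. a \<in> J \<Longrightarrow> b \<in> J \<Longrightarrow> subspace_trace U (\<lambda>v. bracket a (bracket b v)) = 0"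
    and x: "x \<in> J" and u: "u \<in> U"
  shows "\<exists>n. (bracket x ^^ n) u = 0"
proof -
  define cs where "cs = (\<lambda>(c::complex) (f :: 'a \<Rightarrow> complex) b. c * f b)"
  interpret C: complex_linear_space cs
    by unfold_locales (simp_all add: cs_def fun_eq_iff algebra_simps)
  define fs where "fs = (\<lambda>c (a :: ('a \<Rightarrow> complex) \<Rightarrow> ('a \<Rightarrow> complex)) v. cs c (a v))"
  interpret F: complex_linear_space fs
    unfolding fs_def by (rule C.complex_linear_space_opscale)
  obtain B where B: "finite B" "independent B" "span B = U"
    by (rule fin_dim_basis[OF fin_dim_all U(1)])
  define cvec where "cvec = (\<lambda>v b. embed (representation B v b))"
  have cvec_add: "cvec (v + w) = cvec v + cvec w" if "v \<in> U" "w \<in> U" for v w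
    using that B by (simp add: cvec_def fun_eq_iff representation_add embed_add)
  have cvec_scale: "cvec (c *s v) = cs (embed c) (cvec v)" if "v \<in> U" for c v
    using that B by (simp add: cvec_def cs_def fun_eq_iff representation_scale embed_mult)
  have cvec_zero: "cvec 0 = 0"
    by (simp add: cvec_def fun_eq_iff representation_zero embed_zero)
  have cvec_sum: "cvec (\<Sum>i\<in>I. f i) = (\<Sum>i\<in>I. cvec (f i))" if "\<And>i. i \<in> I \<Longrightarrow> f i \<in> U" for I :: "'a set" and f
    using that by (induction I rule: infinite_finite_induct) (simp_all add: cvec_zero cvec_add subspace_sum[OF U(1)])
  have cvec_basis: "cvec b = (\<lambda>c. if c = b then 1 else 0)" if "b \<in> B" for b
    using that B by (simp add: cvec_def fun_eq_iff representation_basis embed_one embed_zero)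
  \<comment> \<open>The complexified action. Values of \<open>f\<close> off \<open>B\<close> are
    ignored, so that \<open>op x\<close> is defined on all functions while its range, for
    \<open>x\<close> in \<open>J\<close>, stays in \<open>V\<close>.\<close>
  define op where "op = (\<lambda>x f. \<Sum>b\<in>B. cs (f b) (cvec (bracket x b)))"
  have op_endo: "C.endo (op x)" for x
    unfolding C.endo_iff op_def
    by (simp add: cs_def fun_eq_iff sum_fun_apply algebra_simps sum.distrib sum_distrib_left)
  have BU: "b \<in> U" if "b \<in> B" for b using that B(3) span_base by blast
  have op_cvec: "op x (cvec v) = cvec (bracket x v)" if "x \<in> J" "v \<in> U" for x v
  proof -
    have "bracket x v = bracket x (\<Sum>b\<in>B. representation B v b *s b)"
      using that B by (simp add: sum_representation_eq)
    also have "\<dots> = (\<Sum>b\<in>B. representation B v b *s bracket x b)"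
      by (simp add: bracket_simps)
    finally have "cvec (bracket x v) = (\<Sum>b\<in>B. cvec (representation B v b *s bracket x b))"
      using that U BU by (simp add: cvec_sum subspace_scale)
    also have "\<dots> = op x (cvec v)"
      unfolding op_def using that U BU by (intro sum.cong) (simp_all add: cvec_scale, simp add: cvec_def)
    finally show ?thesis by simp
  qed
  have op_op: "op x (op y f) = (\<Sum>b\<in>B. cs (f b) (cvec (bracket x (bracket y b))))" if "x \<in> J" "y \<in> J" for x y f
  proof -
    have "op y f = (\<Sum>b\<in>B. cs (f b) (cvec (bracket y b)))" by (simp add: op_def)
    then have "op x (op y f) = (\<Sum>b\<in>B. cs (f b) (op x (cvec (bracket y b))))"
      by (simp only: C.endo_sum[OF op_endo] C.endo_scale[OF op_endo])
    then show ?thesis using that U BU by (simp add: op_cvec)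
  qed
  have cvec_diff: "cvec (v - w) = cvec v - cvec w" if "v \<in> U" "w \<in> U" for v w
    using cvec_add[of "v - w" w] that U(1) by (simp add: subspace_diff)
  have op_bracket: "(\<lambda>f. op x (op y f) - op y (op x f)) = op (bracket x y)" if "x \<in> J" "y \<in> J" for x y
  proof
    fix f
    have "op x (op y f) - op y (op x f) =
        (\<Sum>b\<in>B. cs (f b) (cvec (bracket x (bracket y b)) - cvec (bracket y (bracket x b))))"
      using that by (simp add: op_op sum_subtractf C.scale_right_diff_distrib)
    also have "\<dots> = op (bracket x y) f"
      unfolding op_def using that U BU by (intro sum.cong) (simp_all add: bracket_bracket cvec_diff)
    finally show "op x (op y f) - op y (op x f) = op (bracket x y) f" .
  qed
  define E where "E = cvec ` B"
  define V where "V = C.span E"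
  have finE: "finite E" unfolding E_def using B(1) by simp
  have injB: "inj_on cvec B"
    by (rule inj_onI) (metis cvec_basis zero_neq_one)
  have indE: "C.independent E"
  proof (rule C.independent_if_scalars_zero[OF finE])
    fix f e assume sum0: "(\<Sum>e\<in>E. cs (f e) e) = 0" and "e \<in> E"
    then obtain b where b: "b \<in> B" "e = cvec b" unfolding E_def by blast
    have "0 = (\<Sum>b\<in>B. cs (f (cvec b)) (cvec b)) b"
      using sum0 unfolding E_def by (simp add: sum.reindex[OF injB])
    also have "\<dots> = (\<Sum>b'\<in>B. if b' = b then f (cvec b') else 0)"
      unfolding sum_fun_apply using b by (intro sum.cong) (auto simp: cs_def cvec_basis)
    also have "\<dots> = f e" using b B(1) by simp
    finally show "f e = 0" by simp
  qed
  have V: "C.subspace V" "C.fin_dim V" unfolding V_def C.fin_dim_def using finE by auto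
  have cvecV: "cvec v \<in> V" if "v \<in> U" for v
  proof -
    have "cvec v = cvec (\<Sum>b\<in>B. representation B v b *s b)"
      using that B by (simp add: sum_representation_eq)
    also have "\<dots> = (\<Sum>b\<in>B. cs (embed (representation B v b)) (cvec b))"
      using BU U(1) by (simp add: cvec_sum cvec_scale subspace_scale)
    also have "\<dots> \<in> V"
      unfolding V_def E_def by (intro C.span_sum C.span_scale C.span_base) simp
    finally show ?thesis .
  qed
  have opV: "range (op x) \<subseteq> V" if "x \<in> J" for x
    unfolding op_def using that U BU by (auto intro!: C.subspace_sum[OF V(1)] C.subspace_scale[OF V(1)] cvecV)
  have repE: "C.representation E f (cvec b) = f b" if "f \<in> V" "b \<in> B" for f b
    using that(1) unfolding V_def
  proof (induction rule: C.span_induct_alt_strong)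
    case base
    show ?case unfolding C.representation_zero by (simp add: zero_fun_def)
  next
    case (step c e f)
    then obtain b' where b': "b' \<in> B" "e = cvec b'" unfolding E_def by blast
    have "C.representation E (cs c e + f) (cvec b) = c * C.representation E e (cvec b) + f b"
      using step indE by (simp add: C.representation_add C.representation_scale C.span_base C.span_scale)
    also have "C.representation E e (cvec b) = e b"
    proof -
      have "C.representation E e (cvec b) = (if cvec b = cvec b' then 1 else 0)"
        using C.representation_basis[OF indE step(1)] b'(2) by simp
      also have "\<dots> = (if b = b' then 1 else 0)"
        using inj_on_eq_iff[OF injB that(2) b'(1)] by simp
      finally show ?thesis unfolding b'(2) cvec_basis[OF b'(1)] .
    qed
    finally show ?case by (simp add: cs_def)
  qed
  have tr_op: "C.subspace_trace V (\<lambda>f. op a (op b f)) = 0" if "a \<in> J" "b \<in> J" for a b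
  proof -
    have "C.subspace_trace V (\<lambda>f. op a (op b f)) = (\<Sum>e\<in>E. C.representation E (op a (op b e)) e)"
      using opV[OF that(1)]
      by (intro C.subspace_trace_basis[OF finE indE V_def[symmetric]] C.endo_compose[OF op_endo op_endo]) auto
    also have "\<dots> = (\<Sum>c\<in>B. C.representation E (op a (op b (cvec c))) (cvec c))"
      unfolding E_def by (simp add: sum.reindex[OF injB])
    also have "\<dots> = (\<Sum>c\<in>B. embed (representation B (bracket a (bracket b c)) c))"
      using that U BU by (intro sum.cong) (simp_all add: repE op_cvec cvecV, simp add: cvec_def)
    also have "\<dots> = embed (\<Sum>c\<in>B. representation B (bracket a (bracket b c)) c)"
      by (simp add: embed_sum)
    also have "(\<Sum>c\<in>B. representation B (bracket a (bracket b c)) c) = subspace_trace U (\<lambda>v. bracket a (bracket b v))"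
      using that U by (intro subspace_trace_basis[OF B, symmetric] endo_compose[OF endo_bracket endo_bracket]) auto
    finally show ?thesis using tr0[OF that] embed_zero by simp
  qed
  have op_add: "op (a + b) = op a + op b" if "a \<in> J" "b \<in> J" for a b
    unfolding op_def using that U BU
    by (simp add: fun_eq_iff bracket_simps cvec_add C.scale_right_distrib sum.distrib)
  have op_scale: "op (c *s a) = fs (embed c) (op a)" if "a \<in> J" for c a
    unfolding op_def fs_def using that U BU
    by (simp add: bracket_simps cvec_scale C.scale_sum_right mult.commute)
  have op_zero: "op 0 = 0"
    unfolding op_def by (simp add: fun_eq_iff bracket_simps cvec_zero)
  have op_span: "op z \<in> F.span (op ` A)" if "z \<in> span A" "A \<subseteq> J" for A z
    using that(1)
  proof (induction rule: span_induct_alt_strong)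
    case base
    show ?case unfolding op_zero by (rule F.span_zero)
  next
    case (step c a b)
    have "b \<in> J" using step(2) span_minimal[OF that(2) J(1)] by blast
    moreover have "a \<in> J" using step that(2) by blast
    ultimately have "op (c *s a + b) = fs (embed c) (op a) + op b"
      using subspace_scale[OF J(1)] by (simp add: op_add op_scale)
    moreover have "op a \<in> F.span (op ` A)" using step(1) by (intro F.span_base imageI)
    ultimately show ?case using step(3) F.span_add F.span_scale by metis
  qed
  define JC where "JC = F.span (op ` J)"
  have JCop: "C.endo a \<and> range a \<subseteq> V" if "a \<in> JC" for a
    using that unfolding JC_def
  proof (induction rule: F.span_induct_alt_strong)
    case base
    have "C.endo 0"
      unfolding C.endo_iff by (simp only: zero_fun_apply add_0_left C.scale_zero_right simp_thms)
    moreover have "range 0 \<subseteq> V"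
      unfolding image_subset_iff by (simp only: zero_fun_apply C.subspace_0[OF V(1)] simp_thms ball_simps)
    ultimately show ?case by blast
  next
    case (step c a b)
    then have "C.endo a" "range a \<subseteq> V" using op_endo opV by auto
    then have "C.endo (fs c a + b)" using step
      by (simp add: C.endo_iff fs_def C.scale_right_distrib mult.commute algebra_simps)
    moreover have "range (fs c a + b) \<subseteq> V"
      using step \<open>range a \<subseteq> V\<close> C.subspace_add[OF V(1)] C.subspace_scale[OF V(1)]
      by (auto simp: fs_def image_subset_iff)
    ultimately show ?case by blast
  qed
  have JC_base: "op a \<in> JC" if "a \<in> J" for a unfolding JC_def using that by (intro F.span_base) blast
  have JC_sub: "F.subspace JC" unfolding JC_def by simp
  \<comment> \<open>Closure under commutators and vanishing of the trace form are both bilinear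
    conditions, so on \<open>JC\<close> they reduce to the generators \<open>op x\<close>.\<close>
  have bilinear_induct: "P a b"
    if "a \<in> JC" "b \<in> JC" and gen: "\<And>x y. x \<in> J \<Longrightarrow> y \<in> J \<Longrightarrow> P (op x) (op y)"
      and zero: "\<And>a. a \<in> JC \<Longrightarrow> P a 0" "\<And>a. a \<in> JC \<Longrightarrow> P 0 a"
      and right: "\<And>c a b b'. a \<in> JC \<Longrightarrow> b \<in> JC \<Longrightarrow> b' \<in> JC \<Longrightarrow> P a b \<Longrightarrow> P a b' \<Longrightarrow> P a (fs c b + b')"
      and left: "\<And>c a a' b. a \<in> JC \<Longrightarrow> a' \<in> JC \<Longrightarrow> b \<in> JC \<Longrightarrow> P a b \<Longrightarrow> P a' b \<Longrightarrow> P (fs c a + a') b"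
    for P a b
  proof -
    have 1: "P (op x) b" if "x \<in> J" "b \<in> F.span (op ` J)" for x b
      using that(2)
    proof (induction rule: F.span_induct_alt_strong)
      case base
      then show ?case using zero(1)[OF JC_base[OF that(1)]] .
    next
      case (step c y b)
      then show ?case
        using right[OF JC_base[OF that(1)] _ _ gen[OF that(1)] step(3)] JC_base unfolding JC_def by blast
    qed
    show ?thesis
      using \<open>a \<in> JC\<close> unfolding JC_def
    proof (induction rule: F.span_induct_alt_strong)
      case base
      then show ?case using zero(2) \<open>b \<in> JC\<close> by blast
    next
      case (step c y a')
      then obtain x where x: "x \<in> J" "y = op x" by blast
      then show ?case
        using left[OF JC_base[OF x(1)] _ \<open>b \<in> JC\<close> 1[OF x(1)]] step \<open>b \<in> JC\<close> unfolding JC_def by blast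
    qed
  qed
  have "\<exists>n. (op x ^^ n) (cvec u) = 0"
  proof (rule C.trace_form_zero_imp_nilpotent[OF V, where J = JC, folded fs_def])
    show "F.subspace JC" by (rule JC_sub)
    obtain BJ where BJ: "finite BJ" "independent BJ" "span BJ = J"
      by (rule fin_dim_basis[OF fin_dim_all J(1)])
    have "op ` J \<subseteq> F.span (op ` BJ)"
      using op_span[of _ BJ] BJ(3) span_superset by blast
    then have "JC \<subseteq> F.span (op ` BJ)" unfolding JC_def by (intro F.span_minimal) simp_all
    then show "F.fin_dim JC" unfolding F.fin_dim_def using BJ(1) by blast
    show "op x \<in> JC" by (rule JC_base[OF x])
    show "C.endo a" "range a \<subseteq> V" if "a \<in> JC" for a using JCop[OF that] by auto
    show "(\<lambda>v. a (b v) - b (a v)) \<in> JC" if "a \<in> JC" "b \<in> JC" for a b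
    proof (rule bilinear_induct[OF that])
      fix x y assume "x \<in> J" "y \<in> J"
      then show "(\<lambda>v. op x (op y v) - op y (op x v)) \<in> JC"
        by (simp add: op_bracket JC_base J(2))
    next
      fix a assume "a \<in> JC"
      then have "C.endo a" using JCop by blast
      then have "(\<lambda>v. a ((0 :: ('a \<Rightarrow> complex) \<Rightarrow> ('a \<Rightarrow> complex)) v) - (0 :: ('a \<Rightarrow> complex) \<Rightarrow> ('a \<Rightarrow> complex)) (a v)) = 0"
        "(\<lambda>v. (0 :: ('a \<Rightarrow> complex) \<Rightarrow> ('a \<Rightarrow> complex)) (a v) - a ((0 :: ('a \<Rightarrow> complex) \<Rightarrow> ('a \<Rightarrow> complex)) v)) = 0"
        by (simp_all add: fun_eq_iff C.endo_zero)
      then show "(\<lambda>v. a ((0 :: ('a \<Rightarrow> complex) \<Rightarrow> ('a \<Rightarrow> complex)) v) - (0 :: ('a \<Rightarrow> complex) \<Rightarrow> ('a \<Rightarrow> complex)) (a v)) \<in> JC"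
        "(\<lambda>v. (0 :: ('a \<Rightarrow> complex) \<Rightarrow> ('a \<Rightarrow> complex)) (a v) - a ((0 :: ('a \<Rightarrow> complex) \<Rightarrow> ('a \<Rightarrow> complex)) v)) \<in> JC"
        using F.subspace_0[OF JC_sub] by simp_all
    next
      fix c a b b' assume ab: "a \<in> JC" "b \<in> JC" "b' \<in> JC"
        and IH: "(\<lambda>v. a (b v) - b (a v)) \<in> JC" "(\<lambda>v. a (b' v) - b' (a v)) \<in> JC"
      have "(\<lambda>v. a ((fs c b + b') v) - (fs c b + b') (a v)) =
          fs c (\<lambda>v. a (b v) - b (a v)) + (\<lambda>v. a (b' v) - b' (a v))"
        using JCop[OF ab(1)]
        by (simp add: fun_eq_iff fs_def C.endo_add C.endo_scale C.scale_right_diff_distrib)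
      then show "(\<lambda>v. a ((fs c b + b') v) - (fs c b + b') (a v)) \<in> JC"
        using IH F.subspace_add[OF JC_sub] F.subspace_scale[OF JC_sub] by simp
    next
      fix c a a' b assume ab: "a \<in> JC" "a' \<in> JC" "b \<in> JC"
        and IH: "(\<lambda>v. a (b v) - b (a v)) \<in> JC" "(\<lambda>v. a' (b v) - b (a' v)) \<in> JC"
      have "(\<lambda>v. (fs c a + a') (b v) - b ((fs c a + a') v)) =
          fs c (\<lambda>v. a (b v) - b (a v)) + (\<lambda>v. a' (b v) - b (a' v))"
        using JCop[OF ab(3)]
        by (simp add: fun_eq_iff fs_def C.endo_add C.endo_scale C.scale_right_diff_distrib)
      then show "(\<lambda>v. (fs c a + a') (b v) - b ((fs c a + a') v)) \<in> JC"
        using IH F.subspace_add[OF JC_sub] F.subspace_scale[OF JC_sub] by simp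
    qed
    show "C.subspace_trace V (\<lambda>v. a (b v)) = 0" if "a \<in> JC" "b \<in> JC" for a b
    proof (rule bilinear_induct[OF that])
      fix x y assume "x \<in> J" "y \<in> J"
      then show "C.subspace_trace V (\<lambda>v. op x (op y v)) = 0" by (rule tr_op)
    next
      fix a assume "a \<in> JC"
      then have "(\<lambda>v. a ((0 :: ('a \<Rightarrow> complex) \<Rightarrow> ('a \<Rightarrow> complex)) v)) = (\<lambda>v. 0)" "(\<lambda>v. (0 :: ('a \<Rightarrow> complex) \<Rightarrow> ('a \<Rightarrow> complex)) (a v)) = (\<lambda>v. 0)"
        using JCop[of a] by (simp_all add: fun_eq_iff C.endo_zero)
      then show "C.subspace_trace V (\<lambda>v. a ((0 :: ('a \<Rightarrow> complex) \<Rightarrow> ('a \<Rightarrow> complex)) v)) = 0"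
        "C.subspace_trace V (\<lambda>v. (0 :: ('a \<Rightarrow> complex) \<Rightarrow> ('a \<Rightarrow> complex)) (a v)) = 0"
        using C.subspace_trace_zero[OF V(1)] by (simp_all only:)
    next
      fix c a b b' assume "a \<in> JC"
        and "C.subspace_trace V (\<lambda>v. a (b v)) = 0" "C.subspace_trace V (\<lambda>v. a (b' v)) = 0"
      then show "C.subspace_trace V (\<lambda>v. a ((fs c b + b') v)) = 0"
      proof -
        have "(\<lambda>v. a ((fs c b + b') v)) = (\<lambda>v. cs c (a (b v)) + a (b' v))"
          using JCop[OF \<open>a \<in> JC\<close>] by (simp add: fun_eq_iff fs_def C.endo_add C.endo_scale)
        then show ?thesis
          using \<open>C.subspace_trace V (\<lambda>v. a (b v)) = 0\<close> \<open>C.subspace_trace V (\<lambda>v. a (b' v)) = 0\<close>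
          by (simp only: C.subspace_trace_add[OF V(1)] mult_zero_right add_0_left)
      qed
    next
      fix c a a' b
      assume "a \<in> JC" "a' \<in> JC" "b \<in> JC"
        and "C.subspace_trace V (\<lambda>v. a (b v)) = 0" "C.subspace_trace V (\<lambda>v. a' (b v)) = 0"
      then show "C.subspace_trace V (\<lambda>v. (fs c a + a') (b v)) = 0"
      proof -
        have "(\<lambda>v. (fs c a + a') (b v)) = (\<lambda>v. cs c (a (b v)) + a' (b v))"
          by (simp add: fun_eq_iff fs_def)
        then show ?thesis
          using \<open>C.subspace_trace V (\<lambda>v. a (b v)) = 0\<close> \<open>C.subspace_trace V (\<lambda>v. a' (b v)) = 0\<close>
          by (simp only: C.subspace_trace_add[OF V(1)] mult_zero_right add_0_left)
      qed
    qed
    let ?D = "{\<lambda>v. a (b v) - b (a v) | a b. a \<in> JC \<and> b \<in> JC}"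
    have "op ` {bracket a b | a b. a \<in> J \<and> b \<in> J} \<subseteq> ?D"
    proof
      fix z assume "z \<in> op ` {bracket a b | a b. a \<in> J \<and> b \<in> J}"
      then obtain a b where "a \<in> J" "b \<in> J" "z = op (bracket a b)" by blast
      then have "z = (\<lambda>v. op a (op b v) - op b (op a v))" "op a \<in> JC" "op b \<in> JC"
        by (simp_all add: op_bracket JC_base)
      then show "z \<in> ?D" by blast
    qed
    then have "F.span (op ` {bracket a b | a b. a \<in> J \<and> b \<in> J}) \<subseteq> F.span ?D" by (rule F.span_mono)
    moreover have "{bracket a b | a b. a \<in> J \<and> b \<in> J} \<subseteq> J" using J(2) by blast
    ultimately have "op ` J \<subseteq> F.span ?D" using J(3) op_span by blast
    then show "JC \<subseteq> F.span ?D" unfolding JC_def by (intro F.span_minimal) simp_all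
  qed
  moreover have stable: "(bracket x ^^ n) u \<in> U" for n
    by (induction n) (simp_all add: u U(2)[OF x])
  have "(op x ^^ n) (cvec u) = cvec ((bracket x ^^ n) u)" for n
    by (induction n) (simp_all add: op_cvec[OF x] stable)
  ultimately obtain n where n: "cvec ((bracket x ^^ n) u) = 0" by auto
  then have "representation B ((bracket x ^^ n) u) b = 0" for b
    by (simp add: cvec_def fun_eq_iff embed_eq_0_iff)
  then have "(bracket x ^^ n) u = 0"
    using sum_representation_eq[OF B(2) _ B(1) subset_refl, of "(bracket x ^^ n) u"] stable B(3) by simp
  then show ?thesis by blast
qed

end

section \<open>Engel's theorem and Cartan's criterion\<close>

context lie_algebra_in_complex
begin

text \<open>The locale \<open>finite_dimensional_vector_space\<close> takes a basis as a parameter;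
  fixing one gives access to its dimension theory.\<close>

definition some_basis :: "'a set" where
  "some_basis = (SOME B. finite B \<and> independent B \<and> span B = UNIV)"

lemma some_basis: "finite some_basis \<and> independent some_basis \<and> span some_basis = UNIV"
proof -
  obtain B where "finite B" "independent B" "span B = UNIV"
    by (rule fin_dim_basis[OF fin_dim_all subspace_UNIV])
  then show ?thesis unfolding some_basis_def by (intro someI) blast
qed

sublocale finite_dimensional_vector_space scale some_basis
  by unfold_locales (use some_basis in auto)

text \<open>A relative form of Engel's theorem, in which the induction on \<open>dim J\<close> can be applied
  to the action of a maximal subalgebra \<open>K\<close> on the pair \<open>K \<subset> J\<close>.\<close>

lemma engel:
  assumes "lie_subalgebra J" "subspace W" "subspace W'" "W' \<subset> W"
    and "\<And>a w. a \<in> J \<Longrightarrow> w \<in> W \<Longrightarrow> bracket a w \<in> W"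
    and "\<And>a w. a \<in> J \<Longrightarrow> w \<in> W' \<Longrightarrow> bracket a w \<in> W'"
    and "\<And>a w. a \<in> J \<Longrightarrow> w \<in> W \<Longrightarrow> \<exists>n. (bracket a ^^ n) w = 0"
    and "\<And>a b. a \<in> J \<Longrightarrow> b \<in> J \<Longrightarrow> \<exists>n. (bracket a ^^ n) b = 0"
  shows "\<exists>w. w \<in> W \<and> w \<notin> W' \<and> (\<forall>a\<in>J. bracket a w \<in> W')"
  using assms
proof (induction "dim J" arbitrary: J W W' rule: less_induct)
  case less
  note J = less.prems(1)
  have subJ: "subspace J" and clJ: "\<And>a b. a \<in> J \<Longrightarrow> b \<in> J \<Longrightarrow> bracket a b \<in> J"
    using J unfolding lie_subalgebra_def by auto
  show ?case
  proof (cases "J = {0}")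
    case True
    then show ?thesis using less.prems(3,4) subspace_0 by (auto simp: bracket_simps)
  next
    case False
    let ?P = "\<lambda>K. lie_subalgebra K \<and> K \<subset> J"
    have "?P {0}" using False subspace_0[OF subJ] by (auto simp: lie_subalgebra_def bracket_simps)
    moreover have "\<forall>K. ?P K \<longrightarrow> dim K < Suc (dim J)"
      using dim_subset by (simp add: less_Suc_eq_le psubset_eq)
    \<comment> \<open>A proper subalgebra of largest dimension; \<open>{0}\<close> shows that one
      exists.\<close>
    ultimately obtain K where K: "?P K" and max: "\<And>K'. ?P K' \<Longrightarrow> dim K' \<le> dim K"
      using ex_has_greatest_nat[of ?P "{0}" dim "Suc (dim J)"] by blast
    have subK: "subspace K" and clK: "\<And>a b. a \<in> K \<Longrightarrow> b \<in> K \<Longrightarrow> bracket a b \<in> K"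
      using K unfolding lie_subalgebra_def by auto
    have KJ: "K \<subseteq> J" using K by blast
    have dimK: "dim K < dim J"
      using K subspace_dim_equal[OF subK subJ KJ] by (metis not_le psubset_eq)
    obtain z where z: "z \<in> J" "z \<notin> K" "\<And>k. k \<in> K \<Longrightarrow> bracket k z \<in> K"
    proof -
      have "\<exists>w. w \<in> J \<and> w \<notin> K \<and> (\<forall>a\<in>K. bracket a w \<in> K)"
      proof (rule less.hyps[OF dimK _ subJ subK])
        show "lie_subalgebra K" "K \<subset> J" using K by blast+
        show "bracket a w \<in> J" "\<exists>n. (bracket a ^^ n) w = 0" if "a \<in> K" "w \<in> J" for a w
          using clJ[of a w] less.prems(8)[of a w] that KJ by blast+
        show "bracket a w \<in> K" "\<exists>n. (bracket a ^^ n) w = 0" if "a \<in> K" "w \<in> K" for a w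
          using clK[of a w] less.prems(8)[of a w] that KJ by blast+
      qed
      then show ?thesis using that by blast
    qed
    \<comment> \<open>As \<open>z\<close> normalizes \<open>K\<close>, adding it yields a strictly
      larger subalgebra inside \<open>J\<close>. Maximality makes it equal to \<open>J\<close>, so
      that only \<open>K\<close> and \<open>z\<close> remain to be tested.\<close>
    define K' where "K' = span (insert z K)"
    have K'_iff: "x \<in> K' \<longleftrightarrow> (\<exists>c. x - c *s z \<in> K)" for x
      unfolding K'_def using span_breakdown_eq[of x z K] iffD2[OF span_eq_iff subK] by metis
    have zK: "bracket z k \<in> K" if "k \<in> K" for k
      using z(3)[OF that] bracket_anticommute[of z k] subspace_neg[OF subK] by simp
    have K'J: "K' \<subseteq> J" unfolding K'_def using z(1) KJ subJ by (intro span_minimal) auto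
    have "bracket x y \<in> K'" if "x \<in> K'" "y \<in> K'" for x y
    proof -
      obtain c d where cd: "x - c *s z \<in> K" "y - d *s z \<in> K" using \<open>x \<in> K'\<close> \<open>y \<in> K'\<close> K'_iff by blast
      have "bracket x y = bracket ((x - c *s z) + c *s z) ((y - d *s z) + d *s z)" by simp
      also have "\<dots> = bracket (x - c *s z) (y - d *s z) + d *s bracket (x - c *s z) z
          + c *s bracket z (y - d *s z)"
        by (simp only: bracket_add_left bracket_add_right bracket_scale_left bracket_scale_right bracket_self)
          (simp add: algebra_simps)
      also have "\<dots> \<in> K"
        using clK[OF cd] z(3)[OF cd(1)] zK[OF cd(2)] subK by (simp add: subspace_add subspace_scale)
      finally show ?thesis unfolding K'_def by (simp add: span_base)
    qed
    then have "lie_subalgebra K'" unfolding lie_subalgebra_def K'_def by simp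
    moreover have KK': "K \<subseteq> K'" "z \<in> K'" unfolding K'_def by (auto intro: span_base)
    moreover have "dim K < dim K'"
      using KK' z(2) subspace_dim_equal[OF subK _ KK'(1)] unfolding K'_def by (metis not_le subspace_span)
    ultimately have K'eq: "K' = J" using max[of K'] K'J by fastforce
    obtain w where w: "w \<in> W" "w \<notin> W'" "\<And>k. k \<in> K \<Longrightarrow> bracket k w \<in> W'"
    proof -
      have "\<exists>w. w \<in> W \<and> w \<notin> W' \<and> (\<forall>a\<in>K. bracket a w \<in> W')"
      proof (rule less.hyps[OF dimK _ less.prems(2,3,4)])
        show "lie_subalgebra K" using K by blast
        show "bracket a w \<in> W" "\<exists>n. (bracket a ^^ n) w = 0" if "a \<in> K" "w \<in> W" for a w
          using less.prems(5,7)[of a w] that KJ by blast+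
        show "bracket a w \<in> W'" if "a \<in> K" "w \<in> W'" for a w
          using less.prems(6)[of a w] that KJ by blast
        show "\<exists>n. (bracket a ^^ n) w = 0" if "a \<in> K" "w \<in> K" for a w
          using less.prems(8)[of a w] that KJ by blast
      qed
      then show ?thesis using that by blast
    qed
    \<comment> \<open>The vectors of \<open>W\<close> that \<open>K\<close> sends into
      \<open>W'\<close> are stable under \<open>z\<close>, because \<open>z\<close> normalizes
      \<open>K\<close>.\<close>
    have pow: "(bracket z ^^ n) w \<in> W \<and> (\<forall>k\<in>K. bracket k ((bracket z ^^ n) w) \<in> W')" for n
    proof (induction n)
      case 0
      then show ?case using w by simp
    next
      case (Suc n)
      let ?v = "(bracket z ^^ n) w"
      have "bracket k (bracket z ?v) \<in> W'" if k: "k \<in> K" for k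
      proof -
        have "bracket k (bracket z ?v) = bracket (bracket k z) ?v + bracket z (bracket k ?v)"
          by (simp add: bracket_bracket)
        moreover have "bracket (bracket k z) ?v \<in> W'" using Suc z(3)[OF k] by blast
        moreover have "bracket z (bracket k ?v) \<in> W'" using Suc k less.prems(6) z(1) by blast
        ultimately show ?thesis using less.prems(3) by (simp add: subspace_add)
      qed
      then show ?case using Suc less.prems(5) z(1) by simp
    qed
    obtain n where "(bracket z ^^ n) w = 0" using less.prems(7) z(1) w(1) by blast
    then have ex: "\<exists>n. (bracket z ^^ n) w \<in> W'" using subspace_0[OF less.prems(3)] by metis
    \<comment> \<open>The vector sought is the last power of \<open>z\<close> on \<open>w\<close>
      outside \<open>W'\<close>, hence the exponent just before \<open>n\<close>; there is one since
      \<open>w\<close> itself is outside \<open>W'\<close>.\<close>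
    define n where "n = (LEAST n. (bracket z ^^ n) w \<in> W')"
    have n: "(bracket z ^^ n) w \<in> W'" unfolding n_def using ex by (rule LeastI_ex)
    then have "n \<noteq> 0" using w(2) by (cases n) auto
    then obtain m where m: "n = Suc m" using not0_implies_Suc by blast
    have "(bracket z ^^ m) w \<notin> W'" using not_less_Least[of m "\<lambda>n. (bracket z ^^ n) w \<in> W'"] m n_def by auto
    moreover have "bracket a ((bracket z ^^ m) w) \<in> W'" if "a \<in> J" for a
    proof -
      obtain c where c: "a - c *s z \<in> K" using \<open>a \<in> J\<close> K'eq K'_iff by blast
      have "bracket a ((bracket z ^^ m) w) =
          bracket (a - c *s z) ((bracket z ^^ m) w) + c *s (bracket z ^^ n) w"
        unfolding m by (simp add: bracket_simps)
      then show ?thesis using pow c n less.prems(3) by (simp add: subspace_add subspace_scale)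
    qed
    ultimately show ?thesis using pow by blast
  qed
qed

section \<open>Perfect subalgebras and solvability\<close>

definition perfect :: "'a set \<Rightarrow> bool" where
  "perfect J \<longleftrightarrow> lie_subalgebra J \<and> J \<subseteq> span {bracket a b | a b. a \<in> J \<and> b \<in> J}"

text \<open>If the invariants \<open>W\<close> were proper, Engel's theorem would give
  \<open>w\<close> outside \<open>W\<close> with \<open>J w\<close> inside \<open>W\<close>. Then
  products of two elements of \<open>J\<close> kill \<open>w\<close>, so commutators do, and these
  span \<open>J\<close>.\<close>

lemma perfect_nilpotent_imp_trivial:
  assumes J: "perfect J" and U: "subspace U" "\<And>a u. a \<in> J \<Longrightarrow> u \<in> U \<Longrightarrow> bracket a u \<in> U"
    and nil: "\<And>a w. a \<in> J \<Longrightarrow> w \<in> U \<Longrightarrow> \<exists>n. (bracket a ^^ n) w = 0"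
      "\<And>a b. a \<in> J \<Longrightarrow> b \<in> J \<Longrightarrow> \<exists>n. (bracket a ^^ n) b = 0"
    and "a \<in> J" "u \<in> U"
  shows "bracket a u = 0"
proof -
  define W where "W = {u \<in> U. \<forall>a\<in>J. bracket a u = 0}"
  have W: "subspace W"
    using U(1) by (simp add: W_def subspace_def bracket_simps)
  have "W = U"
  proof (rule ccontr)
    assume "W \<noteq> U"
    then have "W \<subset> U" unfolding W_def by blast
    have stable: "bracket a w \<in> W" if "a \<in> J" "w \<in> W" for a w
      using that subspace_0[OF W] by (simp add: W_def)
    then obtain w where w: "w \<in> U" "w \<notin> W" "\<And>a. a \<in> J \<Longrightarrow> bracket a w \<in> W"
    proof -
      have "\<exists>w. w \<in> U \<and> w \<notin> W \<and> (\<forall>a\<in>J. bracket a w \<in> W)"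
      proof (rule engel[OF _ U(1) W \<open>W \<subset> U\<close> U(2) stable nil])
        show "lie_subalgebra J" using J unfolding perfect_def by blast
      qed
      then show ?thesis using that by blast
    qed
    have "bracket x w \<in> {0}" if "x \<in> J" for x
    proof (rule endo_maps_span[OF endo_bracket_left])
      show "x \<in> span {bracket a b | a b. a \<in> J \<and> b \<in> J}" using J that unfolding perfect_def by blast
      fix y assume "y \<in> {bracket a b | a b. a \<in> J \<and> b \<in> J}"
      then obtain a b where "a \<in> J" "b \<in> J" "y = bracket a b" by blast
      then show "bracket y w \<in> {0}" using w(3) by (simp add: bracket_bracket W_def)
    qed simp
    then have "w \<in> W" using w(1) by (simp add: W_def)
    then show False using w(2) by blast
  qed
  then show ?thesis using assms(6,7) unfolding W_def by blast
qed

lemma derived_series_subalgebra: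
  assumes "lie_subalgebra I"
  shows "lie_subalgebra (derived_series I n) \<and> derived_series I (Suc n) \<subseteq> derived_series I n"
proof (induction n)
  case 0
  have "derived_series I (Suc 0) \<subseteq> I"
    unfolding derived_series.simps using assms unfolding lie_subalgebra_def by (intro span_minimal) blast+
  then show ?case using assms by simp
next
  case (Suc n)
  let ?D = "derived_series I"
  have sub: "?D (Suc n) \<subseteq> ?D n" using Suc by blast
  have cl: "bracket x y \<in> ?D (Suc n)" if "x \<in> ?D (Suc n)" "y \<in> ?D (Suc n)" for x y
    using that sub unfolding derived_series.simps(2)[of I n] by (intro span_base) blast
  moreover have s: "subspace (?D (Suc n))" by simp
  ultimately have "lie_subalgebra (?D (Suc n))" unfolding lie_subalgebra_def by blast
  moreover have "?D (Suc (Suc n)) \<subseteq> ?D (Suc n)"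
    unfolding derived_series.simps(2)[of I "Suc n"] using cl s by (intro span_minimal) blast+
  ultimately show ?case by blast
qed

text \<open>A term of the derived series of least dimension equals its successor and is therefore
  perfect.\<close>

lemma solvableI_perfect:
  assumes I: "lie_subalgebra I" and "\<And>J. perfect J \<Longrightarrow> J \<subseteq> I \<Longrightarrow> J \<subseteq> {0}"
  shows "solvable I"
proof -
  let ?D = "derived_series I"
  note D = derived_series_subalgebra[OF I]
  obtain n where n: "\<And>m. dim (?D n) \<le> dim (?D m)"
    using ex_has_least_nat[of "\<lambda>_. True" 0 "\<lambda>n. dim (?D n)"] by blast
  have "?D (Suc n) = ?D n"
    using D subspace_dim_equal n unfolding lie_subalgebra_def by blast
  then have "perfect (?D n)" using D unfolding perfect_def by auto
  moreover have "?D m \<subseteq> I" for m by (induction m) (use D in force)+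
  ultimately have "?D n \<subseteq> {0}" using assms(2) by blast
  moreover have "0 \<in> ?D n" using D subspace_0 unfolding lie_subalgebra_def by blast
  ultimately show ?thesis unfolding solvable_def by blast
qed

section \<open>Trace forms and Cartan's criterion\<close>

definition trace_form :: "'a set \<Rightarrow> 'a \<Rightarrow> 'a \<Rightarrow> 'k" where
  "trace_form U x y = subspace_trace U (\<lambda>v. bracket x (bracket y v))"

lemma trace_form_bilinear:
  assumes "subspace U"
  shows "trace_form U (x + x') y = trace_form U x y + trace_form U x' y"
    and "trace_form U (c *s x) y = c * trace_form U x y"
    and "trace_form U x (y + y') = trace_form U x y + trace_form U x y'"
    and "trace_form U x (c *s y) = c * trace_form U x y"
  by (simp_all add: trace_form_def bracket_add_left bracket_add_right bracket_scale_left
      bracket_scale_right subspace_trace_add[OF assms])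

lemma trace_form_commute:
  assumes "subspace U" "\<And>u. u \<in> U \<Longrightarrow> bracket x u \<in> U" "\<And>u. u \<in> U \<Longrightarrow> bracket y u \<in> U"
  shows "trace_form U x y = trace_form U y x"
  unfolding trace_form_def
  by (rule subspace_trace_commute[OF fin_dim_all assms(1) endo_bracket _ endo_bracket]) (use assms in auto)

lemma trace_form_invariant:
  assumes "subspace U" "\<And>u. u \<in> U \<Longrightarrow> bracket x u \<in> U" "\<And>u. u \<in> U \<Longrightarrow> bracket y u \<in> U"
    "\<And>u. u \<in> U \<Longrightarrow> bracket z u \<in> U"
  shows "trace_form U (bracket x y) z = trace_form U x (bracket y z)"
proof -
  have "subspace_trace U (\<lambda>v. bracket y (bracket x (bracket z v)))
      = subspace_trace U (\<lambda>v. bracket x (bracket z (bracket y v)))"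
    by (rule subspace_trace_commute[OF fin_dim_all assms(1) endo_bracket _ endo_compose[OF endo_bracket endo_bracket]])
      (use assms in auto)
  then show ?thesis
    by (simp add: trace_form_def bracket_bracket bracket_simps subspace_trace_diff[OF assms(1)])
qed

text \<open>The module is the whole algebra and contains \<open>J\<close> itself, so a trivial
  action already says that all brackets in \<open>J\<close> vanish, and a perfect such
  \<open>J\<close> is zero.\<close>

lemma solvable_if_trace_form_UNIV_zero:
  assumes I: "lie_subalgebra I" and "\<And>a b. a \<in> I \<Longrightarrow> b \<in> I \<Longrightarrow> trace_form UNIV a b = 0"
  shows "solvable I"
proof (rule solvableI_perfect[OF I])
  fix J assume J: "perfect J" "J \<subseteq> I"
  have nil: "\<exists>n. (bracket a ^^ n) w = 0" if "a \<in> J" for a w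
  proof (rule trace_form_zero_imp_ad_nilpotent[where J = J and U = UNIV])
    show "subspace J" "J \<subseteq> span {bracket a b | a b. a \<in> J \<and> b \<in> J}"
      using J(1) unfolding perfect_def lie_subalgebra_def by blast+
    show "bracket a b \<in> J" "subspace_trace UNIV (\<lambda>v. bracket a (bracket b v)) = 0"
      if "a \<in> J" "b \<in> J" for a b
      using J assms(2)[of a b] that unfolding perfect_def lie_subalgebra_def trace_form_def by blast+
  qed (use that in simp_all)
  have triv: "bracket a u = 0" if "a \<in> J" for a u
    by (rule perfect_nilpotent_imp_trivial[OF J(1) subspace_UNIV]) (use nil that in auto)
  have "{bracket a b | a b. a \<in> J \<and> b \<in> J} \<subseteq> {0}" using triv by blast
  then have "span {bracket a b | a b. a \<in> J \<and> b \<in> J} \<subseteq> {0}" by (rule span_minimal) simp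
  then show "J \<subseteq> {0}" using J(1) unfolding perfect_def by blast
qed

text \<open>If the \<open>n\<close>-th power of \<open>x\<close> vanishes on \<open>U\<close>, then
  applying \<open>ad x\<close> to \<open>y\<close> another \<open>2 * n\<close> times gives an
  operator on \<open>U\<close> that is a sum of terms with \<open>y\<close> between \<open>a\<close>
  and \<open>b\<close> factors \<open>x\<close>, where \<open>a + b = 2 * n\<close>. One of
  \<open>a\<close>, \<open>b\<close> is at least \<open>n\<close>, so every term is zero.\<close>

lemma ad_nilpotent_if_faithful:
  assumes U: "subspace U" "\<And>a u. a \<in> J \<Longrightarrow> u \<in> U \<Longrightarrow> bracket a u \<in> U"
    and cl: "\<And>a b. a \<in> J \<Longrightarrow> b \<in> J \<Longrightarrow> bracket a b \<in> J"
    and faithful: "\<And>a. a \<in> J \<Longrightarrow> (\<And>u. u \<in> U \<Longrightarrow> bracket a u = 0) \<Longrightarrow> a = 0"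
    and x: "x \<in> J" "\<And>u. u \<in> U \<Longrightarrow> \<exists>n. (bracket x ^^ n) u = 0" and y: "y \<in> J"
  shows "\<exists>n. (bracket x ^^ n) y = 0"
proof -
  obtain n where n: "\<And>u. u \<in> U \<Longrightarrow> (bracket x ^^ n) u = 0"
    using uniform_nilpotency[OF fin_dim_all U(1) endo_bracket x(2)] by blast
  have powU: "(bracket x ^^ b) u \<in> U" if "u \<in> U" for b u
    using that by (induction b) (simp_all add: U(2)[OF x(1)])
  have n': "(bracket x ^^ b) u = 0" if "u \<in> U" "n \<le> b" for b u
    using funpow_eq_zero_mono[OF endo_bracket n] that by blast
  \<comment> \<open>Unfolding one bracket with \<open>x\<close> moves that factor to the left or to
    the right, so the total \<open>a + b + m\<close> is preserved.\<close>
  have key: "(bracket x ^^ a) (bracket ((bracket x ^^ m) y) ((bracket x ^^ b) u)) = 0"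
    if "2 * n \<le> a + b + m" "u \<in> U" for a b m u
    using that
  proof (induction m arbitrary: a b)
    case 0
    then consider "n \<le> a" | "n \<le> b" by linarith
    then show ?case
    proof cases
      case 1
      then show ?thesis using n'[OF U(2)[OF y powU[OF \<open>u \<in> U\<close>]]] by simp
    next
      case 2
      then show ?thesis using n'[OF \<open>u \<in> U\<close>] endo_zero[OF endo_funpow[OF endo_bracket]] by (simp add: bracket_simps)
    qed
  next
    case (Suc m)
    let ?w = "(bracket x ^^ m) y"
    have 1: "(bracket x ^^ a) (bracket x (bracket ?w ((bracket x ^^ b) u))) = 0"
      using Suc.IH[of "Suc a" b] Suc.prems by (simp add: funpow_swap1)
    have 2: "(bracket x ^^ a) (bracket ?w (bracket x ((bracket x ^^ b) u))) = 0"
      using Suc.IH[of a "Suc b"] Suc.prems by simp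
    show ?case
      using 1 2 by (simp add: bracket_bracket endo_diff[OF endo_funpow[OF endo_bracket]])
  qed
  have "(bracket x ^^ m) y \<in> J" for m by (induction m) (simp_all add: x(1) y cl)
  moreover have "bracket ((bracket x ^^ (2 * n)) y) u = 0" if "u \<in> U" for u
    using key[of 0 0 "2 * n" u] that by simp
  ultimately show ?thesis using faithful by blast
qed

text \<open>Engel's theorem also asks for nilpotency on \<open>J\<close> itself; faithfulness
  provides it through \<open>ad_nilpotent_if_faithful\<close>, and finally turns a trivial action
  into \<open>J = {0}\<close>.\<close>

lemma solvable_if_faithful_trace_form_zero:
  assumes I: "lie_subalgebra I" and U: "subspace U" "\<And>a u. a \<in> I \<Longrightarrow> u \<in> U \<Longrightarrow> bracket a u \<in> U"
    and faithful: "\<And>a. a \<in> I \<Longrightarrow> (\<And>u. u \<in> U \<Longrightarrow> bracket a u = 0) \<Longrightarrow> a = 0"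
    and tr: "\<And>a b. a \<in> I \<Longrightarrow> b \<in> I \<Longrightarrow> trace_form U a b = 0"
  shows "solvable I"
proof (rule solvableI_perfect[OF I])
  fix J assume J: "perfect J" "J \<subseteq> I"
  have cl: "\<And>a b. a \<in> J \<Longrightarrow> b \<in> J \<Longrightarrow> bracket a b \<in> J"
    using J(1) unfolding perfect_def lie_subalgebra_def by blast
  have UJ: "\<And>a u. a \<in> J \<Longrightarrow> u \<in> U \<Longrightarrow> bracket a u \<in> U" using U(2) J(2) by blast
  have nil: "\<exists>n. (bracket a ^^ n) w = 0" if "a \<in> J" "w \<in> U" for a w
  proof (rule trace_form_zero_imp_ad_nilpotent[where J = J and U = U])
    show "subspace J" "J \<subseteq> span {bracket a b | a b. a \<in> J \<and> b \<in> J}"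
      using J(1) unfolding perfect_def lie_subalgebra_def by blast+
    show "subspace_trace U (\<lambda>v. bracket a (bracket b v)) = 0" if "a \<in> J" "b \<in> J" for a b
      using J(2) tr[of a b] that unfolding trace_form_def by blast
  qed (use U(1) UJ cl that in simp_all)
  have nil': "\<exists>n. (bracket a ^^ n) b = 0" if "a \<in> J" "b \<in> J" for a b
    using ad_nilpotent_if_faithful[OF U(1) UJ cl _ that(1) nil[OF that(1)] that(2)] faithful J(2) by blast
  show "J \<subseteq> {0}"
  proof
    fix a assume a: "a \<in> J"
    have "bracket a u = 0" if "u \<in> U" for u
      by (rule perfect_nilpotent_imp_trivial[OF J(1) U(1)]) (use UJ nil nil' a that in auto)
    then show "a \<in> {0}" using faithful a J(2) by blast
  qed
qed

text \<open>The map \<open>\<beta>\<close> has the numbers \<open>form e x\<close> as coordinates.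
  Nondegeneracy makes it injective on \<open>A\<close>, so it is onto by dimension, and
  \<open>d e\<close> is a preimage of \<open>e\<close>.\<close>

lemma dual_basis_exists:
  assumes E: "finite E" "independent E" "span E = A"
    and bilinear: "\<And>x y y'. form x (y + y') = form x y + form x y'"
      "\<And>c x y. form x (c *s y) = c * (form x y :: 'k)"
      "\<And>x x' y. form (x + x') y = form x y + form x' y"
      "\<And>c x y. form (c *s x) y = c * form x y"
    and nondeg: "\<And>x. x \<in> A \<Longrightarrow> (\<And>z. z \<in> A \<Longrightarrow> form z x = 0) \<Longrightarrow> x = 0"
  shows "\<exists>d. \<forall>e\<in>E. d e \<in> A \<and> (\<forall>e'\<in>E. form e' (d e) = (if e' = e then 1 else 0))"
proof -
  interpret pair: finite_dimensional_vector_space_pair_1 scale some_basis scale ..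
  define \<beta> where "\<beta> = (\<lambda>x. \<Sum>e\<in>E. form e x *s e)"
  have \<beta>: "endo \<beta>"
    by (simp add: endo_iff \<beta>_def bilinear scale_left_distrib sum.distrib scale_sum_right)
  have A: "subspace A" using E(3) by auto
  have rep: "representation E (\<beta> x) e = form e x" if "e \<in> E" for x e
    using E(1,2) that
    by (simp add: \<beta>_def representation_sum representation_scale span_base span_scale representation_basis
        if_distrib cong: if_cong)
  have zero: "x = 0" if "x \<in> A" "\<beta> x = 0" for x
  proof (rule nondeg[OF that(1)])
    fix z assume "z \<in> A"
    then have "z \<in> span E" using E(3) by simp
    then show "form z x = 0"
    proof (induction rule: span_induct_alt)
      case base
      then show ?case using bilinear(4)[of 0 0 x] by simp
    next
      case (step c y z)
      then show ?case using rep[of y x] that(2) by (simp add: bilinear representation_zero)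
    qed
  qed
  have "inj_on \<beta> (span A)"
  proof (rule inj_onI)
    fix x y assume "x \<in> span A" "y \<in> span A" "\<beta> x = \<beta> y"
    moreover from this have "x \<in> A" "y \<in> A" unfolding iffD2[OF span_eq_iff A] by auto
    ultimately show "x = y" using zero[of "x - y"] A by (simp add: endo_diff[OF \<beta>] subspace_diff)
  qed
  then have "dim (\<beta> ` A) = dim A" by (rule pair.dim_image_eq[OF \<beta>])
  moreover have "\<beta> ` A \<subseteq> A"
    unfolding \<beta>_def E(3)[symmetric] by (auto intro: span_sum span_scale span_base)
  ultimately have "\<beta> ` A = A"
    using subspace_dim_equal[OF endo_image_subspace[OF \<beta> A] A] by simp
  then have "\<forall>e\<in>E. \<exists>x\<in>A. \<beta> x = e" using E(3) span_base by (metis imageE)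
  then obtain d where d: "\<And>e. e \<in> E \<Longrightarrow> d e \<in> A \<and> \<beta> (d e) = e" by metis
  have "form e' (d e) = (if e' = e then 1 else 0)" if "e \<in> E" "e' \<in> E" for e e'
    using rep[OF that(2), of "d e"] d[OF that(1)] representation_basis[OF E(2) that(1)] by simp
  then show ?thesis using d by blast
qed

end

section \<open>Casimir operators\<close>

context lie_algebra_in_complex
begin

section \<open>Linear functionals\<close>

lemma dual_iff: "f \<in> dual \<longleftrightarrow> (\<forall>x y. f (x + y) = f x + f y) \<and> (\<forall>c x. f (c *s x) = c * f x)"
proof -
  have "vector_space ((*) :: 'k \<Rightarrow> 'k \<Rightarrow> 'k)"
    by unfold_locales (simp_all add: algebra_simps)
  then show ?thesis
    using vector_space_axioms by (simp add: dual_def Vector_Spaces.linear_iff)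
qed

lemma dual_add: "f \<in> dual \<Longrightarrow> f (x + y) = f x + f y"
  and dual_scale: "f \<in> dual \<Longrightarrow> f (c *s x) = c * f x"
  by (simp_all add: dual_iff)

lemma dual_zero: "f \<in> dual \<Longrightarrow> f 0 = 0"
  using dual_scale[of f 0 0] by simp

lemma dual_neg: "f \<in> dual \<Longrightarrow> f (- x) = - f x"
  using dual_scale[of f "-1" x] by simp

lemma dual_diff: "f \<in> dual \<Longrightarrow> f (x - y) = f x - f y"
  using dual_add[of f x "- y"] by (simp add: dual_neg)

lemma dual_sum: "f \<in> dual \<Longrightarrow> f (\<Sum>i\<in>I. g i) = (\<Sum>i\<in>I. f (g i))"
  by (induction I rule: infinite_finite_induct) (simp_all add: dual_zero dual_add)

end

text \<open>Symmetry and invariance are asked on \<open>K\<close> only, since for a trace form they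
  are established for elements that preserve its module.\<close>

locale lie_algebra_invariant_form = lie_algebra_in_complex scale bracket embed
  for scale :: "'k::field \<Rightarrow> 'a::ab_group_add \<Rightarrow> 'a" (infixr \<open>*s\<close> 75) and bracket embed +
  fixes K :: "'a set" and form :: "'a \<Rightarrow> 'a \<Rightarrow> 'k" and E :: "'a set" and d :: "'a \<Rightarrow> 'a"
  assumes subalgebra: "lie_subalgebra K"
    and form_bilinear: "form (x + x') y = form x y + form x' y" "form (c *s x) y = c * form x y"
      "form x (y + y') = form x y + form x y'" "form x (c *s y) = c * form x y"
    and form_commute: "x \<in> K \<Longrightarrow> y \<in> K \<Longrightarrow> form x y = form y x"
    and form_invariant: "x \<in> K \<Longrightarrow> y \<in> K \<Longrightarrow> z \<in> K \<Longrightarrow> form (bracket x y) z = form x (bracket y z)"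
    and E: "finite E" "independent E" "span E = K"
    and d: "e \<in> E \<Longrightarrow> d e \<in> K"
      "e \<in> E \<Longrightarrow> e' \<in> E \<Longrightarrow> form e' (d e) = (if e' = e then 1 else 0)"
begin

lemma subspace_K: "subspace K" and bracket_K: "x \<in> K \<Longrightarrow> y \<in> K \<Longrightarrow> bracket x y \<in> K"
  using subalgebra unfolding lie_subalgebra_def by auto

lemma E_in_K: "e \<in> E \<Longrightarrow> e \<in> K"
  using E(3) span_base by blast

lemma form_dual_left: "form x \<in> dual" and form_dual_right: "(\<lambda>y. form y x) \<in> dual"
  by (simp_all add: dual_iff form_bilinear)

lemma representation_form:
  assumes "v \<in> K" "e \<in> E"
  shows "representation E v e = form v (d e)"
proof -
  have "form v (d e) = form (\<Sum>f\<in>E. representation E v f *s f) (d e)"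
    using assms E by (simp add: sum_representation_eq)
  also have "\<dots> = (\<Sum>f\<in>E. representation E v f * form f (d e))"
    by (simp add: dual_sum[OF form_dual_right] form_bilinear)
  also have "\<dots> = (\<Sum>f\<in>E. if f = e then representation E v f else 0)"
    using assms(2) by (intro sum.cong) (simp_all add: d(2))
  also have "\<dots> = representation E v e"
    using E(1) assms(2) by simp
  finally show ?thesis by simp
qed

lemma expand_basis: "v \<in> K \<Longrightarrow> (\<Sum>e\<in>E. form v (d e) *s e) = v"
  using sum_representation_eq[OF E(2) _ E(1) subset_refl, of v] E(3) by (simp add: representation_form)

lemma nondegenerate: "v \<in> K \<Longrightarrow> (\<And>z. z \<in> K \<Longrightarrow> form v z = 0) \<Longrightarrow> v = 0"
  using expand_basis[of v] d(1) by simp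

lemma nondegenerate_eqI:
  assumes "v \<in> K" "w \<in> K" "\<And>z. z \<in> K \<Longrightarrow> form v z = form w z"
  shows "v = w"
proof -
  have "v - w \<in> K" using assms subspace_K by (simp add: subspace_diff)
  moreover have "form (v - w) z = 0" if "z \<in> K" for z
    using assms(3)[OF that] by (simp add: dual_diff[OF form_dual_right])
  ultimately show ?thesis using nondegenerate by fastforce
qed

lemma expand_dual_basis:
  assumes "v \<in> K"
  shows "(\<Sum>e\<in>E. form v e *s d e) = v"
proof (rule nondegenerate_eqI)
  show "(\<Sum>e\<in>E. form v e *s d e) \<in> K"
    using subspace_K d(1) by (simp add: subspace_sum subspace_scale)
  fix z assume z: "z \<in> K"
  have "form (\<Sum>e\<in>E. form v e *s d e) z = (\<Sum>e\<in>E. form v e * form (d e) z)"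
    by (simp add: dual_sum[OF form_dual_right] form_bilinear)
  also have "\<dots> = (\<Sum>e\<in>E. form z (d e) * form v e)"
    using z d(1) form_commute by (simp add: mult.commute)
  also have "\<dots> = form v (\<Sum>e\<in>E. form z (d e) *s e)"
    by (simp add: dual_sum[OF form_dual_left] form_bilinear)
  also have "\<dots> = form v z" using expand_basis[OF z] by simp
  finally show "form (\<Sum>e\<in>E. form v e *s d e) z = form v z" .
qed (rule assms)

lemma trace_form_expansion:
  assumes "endo f" "f ` K \<subseteq> K"
  shows "subspace_trace K f = (\<Sum>e\<in>E. form (f e) (d e))"
proof -
  have "f e \<in> K" if "e \<in> E" for e using assms(2) E_in_K[OF that] by blast
  then show ?thesis
    using subspace_trace_basis[OF E assms] by (simp add: representation_form)
qed

definition riesz :: "('a \<Rightarrow> 'k) \<Rightarrow> 'a" where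
  "riesz f = (\<Sum>e\<in>E. f (d e) *s e)"

lemma riesz_in_K: "riesz f \<in> K"
  unfolding riesz_def using subspace_K E_in_K by (simp add: subspace_sum subspace_scale)

lemma form_riesz:
  assumes "f \<in> dual" "z \<in> K"
  shows "form (riesz f) z = f z"
proof -
  have "form (riesz f) z = (\<Sum>e\<in>E. f (d e) * form e z)"
    unfolding riesz_def by (simp add: dual_sum[OF form_dual_right] form_bilinear)
  also have "\<dots> = f (\<Sum>e\<in>E. form z e *s d e)"
    using assms E_in_K form_commute by (simp add: dual_sum dual_scale mult.commute)
  finally show ?thesis using expand_dual_basis[OF assms(2)] by simp
qed

definition casimir :: "'a \<Rightarrow> 'a" where
  "casimir y = (\<Sum>e\<in>E. bracket (d e) (bracket e y))"

lemma endo_casimir: "endo casimir"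
  by (simp add: endo_iff casimir_def bracket_add_right bracket_scale_right sum.distrib scale_sum_right)

lemma casimir_in:
  assumes "subspace U" "\<And>x u. x \<in> K \<Longrightarrow> u \<in> U \<Longrightarrow> bracket x u \<in> U" "u \<in> U"
  shows "casimir u \<in> U"
  unfolding casimir_def using assms E_in_K d(1) by (simp add: subspace_sum)

text \<open>Bracketing with \<open>z\<close> differentiates both factors of each summand. Expanding
  \<open>[z, d e]\<close> in the dual basis and \<open>[z, e]\<close> in the basis gives double sums
  whose coefficients are opposite by invariance.\<close>

lemma casimir_commute:
  assumes z: "z \<in> K"
  shows "bracket z (casimir y) = casimir (bracket z y)"
proof -
  have inv: "form (bracket z f) (d e) = - form (bracket z (d e)) f" if "e \<in> E" "f \<in> E" for e f
  proof -
    have "form (bracket z f) (d e) = - form (bracket f z) (d e)"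
      using bracket_anticommute[of z f] by (simp add: dual_neg[OF form_dual_right])
    also have "\<dots> = - form f (bracket z (d e))"
      using form_invariant that E_in_K d(1) z by simp
    also have "\<dots> = - form (bracket z (d e)) f"
      using form_commute that E_in_K d(1) z bracket_K by simp
    finally show ?thesis .
  qed
  have "bracket z (casimir y) - casimir (bracket z y) =
      (\<Sum>e\<in>E. bracket (bracket z (d e)) (bracket e y)) + (\<Sum>e\<in>E. bracket (d e) (bracket (bracket z e) y))"
    by (simp add: casimir_def bracket_simps bracket_bracket sum.distrib[symmetric] sum_subtractf[symmetric])
  moreover have "(\<Sum>e\<in>E. bracket (bracket z (d e)) (bracket e y)) =
      (\<Sum>e\<in>E. \<Sum>f\<in>E. form (bracket z (d e)) f *s bracket (d f) (bracket e y))"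
  proof (rule sum.cong[OF refl])
    fix e assume "e \<in> E"
    then have "bracket z (d e) \<in> K" using z d(1) bracket_K by blast
    then have "bracket (bracket z (d e)) (bracket e y) =
        bracket (\<Sum>f\<in>E. form (bracket z (d e)) f *s d f) (bracket e y)"
      using expand_dual_basis by simp
    then show "bracket (bracket z (d e)) (bracket e y) =
        (\<Sum>f\<in>E. form (bracket z (d e)) f *s bracket (d f) (bracket e y))"
      by (simp add: bracket_simps)
  qed
  moreover have "(\<Sum>e\<in>E. bracket (d e) (bracket (bracket z e) y)) =
      (\<Sum>e\<in>E. \<Sum>f\<in>E. form (bracket z e) (d f) *s bracket (d e) (bracket f y))"
  proof (rule sum.cong[OF refl])
    fix e assume "e \<in> E"
    then have "bracket z e \<in> K" using z E_in_K bracket_K by blast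
    then have "bracket (d e) (bracket (bracket z e) y) =
        bracket (d e) (bracket (\<Sum>f\<in>E. form (bracket z e) (d f) *s f) y)"
      using expand_basis by simp
    then show "bracket (d e) (bracket (bracket z e) y) =
        (\<Sum>f\<in>E. form (bracket z e) (d f) *s bracket (d e) (bracket f y))"
      by (simp add: bracket_simps)
  qed
  moreover have "(\<Sum>e\<in>E. \<Sum>f\<in>E. form (bracket z e) (d f) *s bracket (d e) (bracket f y)) =
      (\<Sum>e\<in>E. \<Sum>f\<in>E. - (form (bracket z (d e)) f *s bracket (d f) (bracket e y)))"
    by (subst sum.swap) (simp add: inv)
  ultimately show ?thesis by (simp add: sum_negf)
qed

lemma trace_casimir:
  assumes "subspace U"
  shows "subspace_trace U casimir = (\<Sum>e\<in>E. trace_form U (d e) e)"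
  unfolding casimir_def[abs_def] trace_form_def by (rule subspace_trace_sum[OF assms])

text \<open>Write \<open>\<phi> y\<close> and \<open>m\<close> for the elements of \<open>K\<close> representing \<open>lam [y,\<cdot>]\<close> and \<open>mu\<close>.  The hypothesis says
  \<open>\<phi> y = [m,x]\<close> with \<open>x\<close> in the stabilizer of \<open>lam\<close>, and it forces \<open>m\<close> into the stabilizer as well.
  So \<open>N = \<phi> U\<close> lies in the stabilizer, which normalizes \<open>N\<close>, and up to sign \<open>lam (casimir y)\<close> is the trace
  of \<open>ad [m,x]\<close> on \<open>N\<close>, which vanishes.\<close>

lemma functional_casimir_eq_0:
  assumes lam: "lam \<in> dual" and mu: "mu \<in> dual"
    and U: "subspace U" "\<And>x u. x \<in> K \<Longrightarrow> u \<in> U \<Longrightarrow> bracket x u \<in> U"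
    and hyp: "\<And>y. y \<in> U \<Longrightarrow> \<exists>x\<in>K. (\<forall>u\<in>U. lam (bracket x u) = 0) \<and>
      (\<forall>z\<in>K. lam (bracket y z) = mu (bracket x z))"
    and y: "y \<in> U"
  shows "lam (casimir y) = 0"
proof -
  define \<phi> where "\<phi> = (\<lambda>y. riesz (\<lambda>z. lam (bracket y z)))"
  define m where "m = riesz mu"
  define H where "H = {x \<in> K. \<forall>u\<in>U. lam (bracket x u) = 0}"
  define N where "N = \<phi> ` U"
  have \<phi>K: "\<phi> y \<in> K" for y unfolding \<phi>_def by (rule riesz_in_K)
  have mK: "m \<in> K" unfolding m_def by (rule riesz_in_K)
  have form_\<phi>: "form (\<phi> y) z = lam (bracket y z)" if "z \<in> K" for y z
    unfolding \<phi>_def using lam that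
    by (intro form_riesz) (simp_all add: dual_iff bracket_add_right bracket_scale_right)
  have form_m: "form m z = mu z" if "z \<in> K" for z
    unfolding m_def using mu that by (rule form_riesz)
  have \<phi>_endo: "endo \<phi>"
    using lam unfolding endo_iff \<phi>_def riesz_def
    by (simp add: bracket_add_left bracket_scale_left dual_add dual_scale scale_left_distrib sum.distrib scale_sum_right)
  have stab: "\<exists>x\<in>H. \<phi> y = bracket m x \<and> lam (bracket y m) = 0" if yU: "y \<in> U" for y
  proof -
    obtain x where x: "x \<in> H" "\<And>z. z \<in> K \<Longrightarrow> lam (bracket y z) = mu (bracket x z)"
      using hyp[OF yU] unfolding H_def by blast
    have xK: "x \<in> K" using x(1) unfolding H_def by blast
    have "\<phi> y = bracket m x"
    proof (rule nondegenerate_eqI[OF \<phi>K bracket_K[OF mK xK]])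
      fix z assume "z \<in> K"
      then show "form (\<phi> y) z = form (bracket m x) z"
        using x(2) form_\<phi> form_invariant[OF mK xK] form_m bracket_K xK by simp
    qed
    \<comment> \<open>The value is \<open>form m (bracket x m)\<close>, which invariance and
      symmetry identify with its own negative.\<close>
    moreover have "lam (bracket y m) = 0"
    proof -
      have lam_m: "lam (bracket y m) = form m (bracket x m)" using x(2)[OF mK] form_m bracket_K xK mK by simp
      have "form m (bracket x m) = form (bracket m x) m" using form_invariant[OF mK xK mK] by (rule sym)
      also have "\<dots> = form m (bracket m x)" using bracket_K xK mK by (intro form_commute)
      also have "\<dots> = - form m (bracket x m)"
        using bracket_anticommute[of m x] dual_neg[OF form_dual_left] by metis
      finally have "form m (bracket x m) + form m (bracket x m) = 0"
        by (metis add.right_inverse)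
      then have "of_nat 2 * form m (bracket x m) = 0" by (simp only: of_nat_numeral mult_2)
      then have "form m (bracket x m) = 0" using of_nat_nonzero[of 2] mult_eq_0_iff by (metis zero_neq_numeral)
      then show ?thesis using lam_m by simp
    qed
    ultimately show ?thesis using x(1) by blast
  qed
  have mH: "m \<in> H"
  proof -
    have "lam (bracket m u) = 0" if "u \<in> U" for u
      using stab[OF that] bracket_anticommute[of m u] lam by (auto simp: dual_neg)
    then show ?thesis unfolding H_def using mK by simp
  qed
  have H_bracket: "bracket a b \<in> H" if "a \<in> H" "b \<in> H" for a b
    using that U(2) bracket_K unfolding H_def by (simp add: bracket_bracket dual_diff[OF lam])
  \<comment> \<open>Commuting \<open>z\<close> past \<open>\<phi>\<close> leaves the error
    \<open>lam (bracket z (bracket y w))\<close>; it vanishes for \<open>z\<close> in the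
    stabilizer, because \<open>bracket y w\<close> lies in \<open>U\<close>.\<close>
  have equivariant: "bracket z (\<phi> y) = \<phi> (bracket z y)" if z: "z \<in> H" and y: "y \<in> U" for z y
  proof (rule nondegenerate_eqI)
    have zK: "z \<in> K" using z unfolding H_def by blast
    then show "bracket z (\<phi> y) \<in> K" using \<phi>K bracket_K by blast
    show "\<phi> (bracket z y) \<in> K" by (rule \<phi>K)
    fix w assume w: "w \<in> K"
    have "form (bracket z (\<phi> y)) w = - form (bracket (\<phi> y) z) w"
      using bracket_anticommute[of z "\<phi> y"] by (simp add: dual_neg[OF form_dual_right])
    also have "\<dots> = - lam (bracket y (bracket z w))"
      using form_invariant[OF \<phi>K zK w] form_\<phi> bracket_K zK w by simp
    also have "\<dots> = lam (bracket z (bracket y w)) - lam (bracket y (bracket z w))"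
    proof -
      have "bracket y w \<in> U" using U(2)[OF w y] bracket_anticommute[of y w] U(1) by (simp add: subspace_neg)
      then show ?thesis using z unfolding H_def by simp
    qed
    also have "\<dots> = form (\<phi> (bracket z y)) w"
      using form_\<phi>[OF w] lam by (simp add: bracket_bracket dual_diff)
    finally show "form (bracket z (\<phi> y)) w = form (\<phi> (bracket z y)) w" .
  qed
  have NH: "N \<subseteq> H"
  proof
    fix n assume "n \<in> N"
    then obtain x where "x \<in> H" "n = bracket m x" using stab unfolding N_def by blast
    then show "n \<in> H" using H_bracket mH by blast
  qed
  have HN: "bracket z n \<in> N" if zn: "z \<in> H" "n \<in> N" for z n
  proof -
    obtain u where "u \<in> U" "n = \<phi> u" using zn(2) unfolding N_def by blast
    then show ?thesis using equivariant[OF zn(1)] U(2) zn(1) unfolding N_def H_def by auto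
  qed
  have subN: "subspace N" unfolding N_def by (rule endo_image_subspace[OF \<phi>_endo U(1)])
  have NK: "N \<subseteq> K" using NH unfolding H_def by blast
  obtain x where x: "x \<in> H" "\<phi> y = bracket m x" using stab[OF y] by blast
  \<comment> \<open>In dual bases the trace of this map on \<open>K\<close> is
    \<open>- lam (casimir y)\<close>. Its range lies in \<open>N\<close>, so the trace may be
    computed there.\<close>
  let ?\<psi> = "\<lambda>z. \<phi> (bracket z y)"
  have \<psi>_endo: "endo ?\<psi>" by (rule endo_compose[OF \<phi>_endo endo_bracket_left])
  have \<psi>N: "?\<psi> ` K \<subseteq> N" using U(2) y unfolding N_def by blast
  have "lam (casimir y) = (\<Sum>e\<in>E. lam (bracket (d e) (bracket e y)))"
    unfolding casimir_def by (rule dual_sum[OF lam])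
  also have "\<dots> = (\<Sum>e\<in>E. - form (?\<psi> e) (d e))"
  proof (rule sum.cong[OF refl])
    fix e assume "e \<in> E"
    then show "lam (bracket (d e) (bracket e y)) = - form (?\<psi> e) (d e)"
      using form_\<phi>[of "d e" "bracket e y"] d(1) bracket_anticommute[of "d e" "bracket e y"] lam
      by (simp add: dual_neg)
  qed
  also have "\<dots> = - subspace_trace K ?\<psi>"
    using trace_form_expansion[OF \<psi>_endo] \<psi>N NK by (auto simp: sum_negf)
  also have "subspace_trace K ?\<psi> = subspace_trace N ?\<psi>"
    by (rule subspace_trace_range[OF fin_dim_all subspace_K subN NK \<psi>_endo \<psi>N])
  \<comment> \<open>Elements of \<open>N\<close> stabilize \<open>lam\<close>, so equivariance turns
    the map into bracketing with \<open>\<phi> y = bracket m x\<close>. This is a commutator of two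
    operators that preserve \<open>N\<close>.\<close>
  also have "\<dots> = subspace_trace N (\<lambda>z. bracket x (bracket m z) - bracket m (bracket x z))"
  proof (rule subspace_trace_cong[OF subN])
    fix z assume "z \<in> N"
    then have "?\<psi> z = bracket z (bracket m x)" using equivariant[of z y] NH y x(2) by auto
    also have "\<dots> = - bracket (bracket m x) z" by (rule bracket_anticommute)
    finally show "?\<psi> z = bracket x (bracket m z) - bracket m (bracket x z)" by (simp add: bracket_bracket)
  qed
  also have "\<dots> = 0"
    using subspace_trace_commute[OF fin_dim_all subN endo_bracket _ endo_bracket, of x m] HN x(1) mH
    by (auto simp: subspace_trace_diff[OF subN])
  finally show ?thesis by simp
qed

end

section \<open>Induction on the module\<close>

context lie_algebra_in_complex
begin

lemma lie_ideal_subalgebra: "lie_ideal I r \<Longrightarrow> lie_subalgebra I"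
  unfolding lie_ideal_def lie_subalgebra_def by blast

text \<open>The trace form of the whole algebra acts as a Killing form. It vanishes on
  \<open>K \<inter> K0\<close>, a solvable ideal and hence zero, so it is nondegenerate on
  \<open>K0\<close>, and a dual basis there gives the orthogonal projection
  \<open>x0\<close>.\<close>

lemma eq_sum_zero_split:
  assumes r: "lie_subalgebra r" "semisimple r"
    and K0: "lie_ideal K0 r"
  defines "K \<equiv> {x \<in> r. \<forall>z\<in>K0. trace_form UNIV x z = 0}"
  shows "lie_ideal K r" and "K \<inter> K0 = {0}" and "x \<in> r \<Longrightarrow> \<exists>x0\<in>K0. x - x0 \<in> K"
proof -
  let ?f = "trace_form UNIV"
  note bil = trace_form_bilinear[OF subspace_UNIV]
  have comm: "?f x y = ?f y x" for x y by (rule trace_form_commute) auto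
  have inv: "?f (bracket x y) z = ?f x (bracket y z)" for x y z by (rule trace_form_invariant) auto
  have left: "?f x \<in> dual" and right: "(\<lambda>x. ?f x y) \<in> dual" for x y by (simp_all add: dual_iff bil)
  have subr: "subspace r" and clr: "\<And>x y. x \<in> r \<Longrightarrow> y \<in> r \<Longrightarrow> bracket x y \<in> r"
    using r(1) unfolding lie_subalgebra_def by auto
  have subK0: "subspace K0" and K0r: "K0 \<subseteq> r" and idK0: "\<And>x y. x \<in> r \<Longrightarrow> y \<in> K0 \<Longrightarrow> bracket x y \<in> K0"
    using K0 unfolding lie_ideal_def by auto
  have subK: "subspace K"
    using subr by (simp add: K_def subspace_def bil dual_zero[OF right])
  have idK: "bracket w x \<in> K" if "w \<in> r" "x \<in> K" for w x
  proof -
    have "?f (bracket w x) z = 0" if "z \<in> K0" for z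
    proof -
      have "?f (bracket w x) z = - ?f (bracket x w) z"
        using bracket_anticommute[of w x] by (simp add: dual_neg[OF right])
      also have "\<dots> = 0"
        using idK0[OF \<open>w \<in> r\<close> that] \<open>x \<in> K\<close> by (simp add: inv K_def)
      finally show ?thesis .
    qed
    then show ?thesis using that clr by (simp add: K_def)
  qed
  show "lie_ideal K r" unfolding lie_ideal_def using subK idK by (auto simp: K_def)
  have ideal: "lie_ideal (K \<inter> K0) r"
    unfolding lie_ideal_def using subspace_inter[OF subK subK0] K0r idK idK0 by auto
  moreover have "solvable (K \<inter> K0)"
    by (rule solvable_if_trace_form_UNIV_zero[OF lie_ideal_subalgebra[OF ideal]]) (auto simp: K_def)
  ultimately show disj: "K \<inter> K0 = {0}" using r(2) unfolding semisimple_def by blast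
  show "\<exists>x0\<in>K0. x - x0 \<in> K" if x: "x \<in> r"
  proof -
    obtain E where E: "finite E" "independent E" "span E = K0"
      by (rule fin_dim_basis[OF fin_dim_all subK0])
    have "z = 0" if "z \<in> K0" "\<And>w. w \<in> K0 \<Longrightarrow> ?f w z = 0" for z
    proof -
      have "z \<in> K" using that K0r by (auto simp: K_def comm[of z])
      then show ?thesis using disj that(1) by blast
    qed
    then obtain d where d: "\<And>e. e \<in> E \<Longrightarrow> d e \<in> K0"
      "\<And>e e'. e \<in> E \<Longrightarrow> e' \<in> E \<Longrightarrow> ?f e' (d e) = (if e' = e then 1 else 0)"
      using dual_basis_exists[OF E, of ?f] bil by metis
    define x0 where "x0 = (\<Sum>e\<in>E. ?f x e *s d e)"
    have x0: "x0 \<in> K0" unfolding x0_def using d(1) subK0 by (simp add: subspace_sum subspace_scale)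
    have eq: "?f (x - x0) e' = 0" if "e' \<in> E" for e'
    proof -
      have "?f x0 e' = (\<Sum>e\<in>E. ?f x e * ?f e' (d e))"
        unfolding x0_def by (simp add: dual_sum[OF right] bil comm[of e'])
      also have "\<dots> = (\<Sum>e\<in>E. if e' = e then ?f x e else 0)"
        using that by (intro sum.cong) (simp_all add: d(2))
      also have "\<dots> = ?f x e'" using that E(1) by simp
      finally show ?thesis by (simp add: dual_diff[OF right])
    qed
    have "?f (x - x0) z = 0" if "z \<in> K0" for z
    proof -
      have "z \<in> span E" using that E(3) by simp
      then show ?thesis
      proof (induction rule: span_induct_alt)
        case base
        show ?case by (rule dual_zero[OF left])
      next
        case (step c e z)
        then show ?case using eq by (simp add: bil)
      qed
    qed
    moreover have "x - x0 \<in> r" using x x0 K0r subr by (blast intro: subspace_diff)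
    ultimately show ?thesis using x0 by (auto simp: K_def)
  qed
qed

text \<open>Stabilizing \<open>lam\<close> is tested on \<open>U\<close> only, while
  \<open>mu\<close> and \<open>r\<close> stay fixed. A witness for \<open>U\<close> therefore
  remains a witness for each smaller module, as the induction requires.\<close>

lemma functional_eq_0:
  assumes r: "lie_subalgebra r" "semisimple r" and lam: "lam \<in> dual" and mu: "mu \<in> dual"
    and U: "subspace U" "\<And>x u. x \<in> r \<Longrightarrow> u \<in> U \<Longrightarrow> bracket x u \<in> U"
    and inv: "invariants r U = {0}"
    and hyp: "\<And>y. y \<in> U \<Longrightarrow> \<exists>x\<in>r. (\<forall>u\<in>U. lam (bracket x u) = 0) \<and>
      (\<forall>z\<in>r. lam (bracket y z) = mu (bracket x z))"
    and y: "y \<in> U"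
  shows "lam y = 0"
  using U inv hyp y
proof (induction "dim U" arbitrary: U y rule: less_induct)
  case less
  note subU = less.prems(1) and stab = less.prems(2)
  define K0 where "K0 = {x \<in> r. \<forall>u\<in>U. bracket x u = 0}"
  have subr: "subspace r" and clr: "\<And>x y. x \<in> r \<Longrightarrow> y \<in> r \<Longrightarrow> bracket x y \<in> r"
    using r(1) unfolding lie_subalgebra_def by auto
  have K0: "lie_ideal K0 r"
    unfolding lie_ideal_def
  proof (intro conjI ballI)
    show "subspace K0" using subr by (simp add: K0_def subspace_def bracket_simps)
    show "K0 \<subseteq> r" by (auto simp: K0_def)
    show "bracket x z \<in> K0" if "x \<in> r" "z \<in> K0" for x z
      using that stab clr by (simp add: K0_def bracket_bracket bracket_simps)
  qed
  define K where "K = {x \<in> r. \<forall>z\<in>K0. trace_form UNIV x z = 0}"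
  note split = eq_sum_zero_split[OF r K0, folded K_def]
  have subK: "lie_subalgebra K" using lie_ideal_subalgebra[OF split(1)] .
  have Kr: "K \<subseteq> r" by (auto simp: K_def)
  have idK: "\<And>w x. w \<in> r \<Longrightarrow> x \<in> K \<Longrightarrow> bracket w x \<in> K" using split(1) unfolding lie_ideal_def by blast
  have stabK: "\<And>x u. x \<in> K \<Longrightarrow> u \<in> U \<Longrightarrow> bracket x u \<in> U" using Kr stab by blast
  have faithful: "x = 0" if "x \<in> K" "\<And>u. u \<in> U \<Longrightarrow> bracket x u = 0" for x
    using that split(2) Kr unfolding K0_def by blast
  note bil = trace_form_bilinear[OF subU]
  have comm: "trace_form U x z = trace_form U z x" if "x \<in> r" "z \<in> r" for x z
    by (rule trace_form_commute[OF subU]) (use that stab in auto)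
  have invar: "trace_form U (bracket x w) z = trace_form U x (bracket w z)" if "x \<in> r" "w \<in> r" "z \<in> r" for x w z
    by (rule trace_form_invariant[OF subU]) (use that stab in auto)
  have right: "(\<lambda>x. trace_form U x z) \<in> dual" and left: "trace_form U z \<in> dual" for z
    by (simp_all add: dual_iff bil)
  \<comment> \<open>The radical of the trace form of \<open>U\<close> on \<open>K\<close>. It is an
    ideal of all of \<open>r\<close> by invariance, and solvable because \<open>K\<close>, meeting
    \<open>K0\<close> in zero, acts faithfully on \<open>U\<close>; semisimplicity removes
    it.\<close>
  define R where "R = {x \<in> K. \<forall>z\<in>K. trace_form U z x = 0}"
  have R: "lie_ideal R r"
    unfolding lie_ideal_def
  proof (intro conjI ballI)
    show "subspace R"
      using subK unfolding lie_subalgebra_def by (simp add: R_def subspace_def bil dual_zero[OF left])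
    show "R \<subseteq> r" using Kr by (auto simp: R_def)
    fix w x assume w: "w \<in> r" and x: "x \<in> R"
    have "trace_form U z (bracket w x) = 0" if z: "z \<in> K" for z
    proof -
      have "trace_form U z (bracket w x) = trace_form U (bracket z w) x"
        using z x Kr by (intro invar[OF _ w, symmetric]) (auto simp: R_def)
      also have "\<dots> = - trace_form U (bracket w z) x"
        using bracket_anticommute[of z w] by (simp add: dual_neg[OF right])
      also have "\<dots> = 0" using idK[OF w z] x by (simp add: R_def)
      finally show ?thesis .
    qed
    then show "bracket w x \<in> R" using idK w x by (simp add: R_def)
  qed
  have "solvable R"
  proof (rule solvable_if_faithful_trace_form_zero[OF lie_ideal_subalgebra[OF R] subU])
    show "bracket a u \<in> U" if "a \<in> R" "u \<in> U" for a u using that stabK by (simp add: R_def)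
    show "a = 0" if "a \<in> R" "\<And>u. u \<in> U \<Longrightarrow> bracket a u = 0" for a
      using that faithful by (simp add: R_def)
    show "trace_form U a b = 0" if "a \<in> R" "b \<in> R" for a b using that by (simp add: R_def)
  qed
  then have "R = {0}" using R r(2) unfolding semisimple_def by blast
  then have nondeg: "x = 0" if "x \<in> K" "\<And>z. z \<in> K \<Longrightarrow> trace_form U z x = 0" for x
    using that by (auto simp: R_def)
  obtain E where E: "finite E" "independent E" "span E = K"
    using fin_dim_basis[OF fin_dim_all, of K] subK unfolding lie_subalgebra_def by metis
  obtain d where d: "\<And>e. e \<in> E \<Longrightarrow> d e \<in> K"
    "\<And>e e'. e \<in> E \<Longrightarrow> e' \<in> E \<Longrightarrow> trace_form U e' (d e) = (if e' = e then 1 else 0)"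
    using dual_basis_exists[OF E, of "trace_form U"] bil nondeg by metis
  interpret C: lie_algebra_invariant_form scale bracket embed K "trace_form U" E d
  proof
    fix x y z assume K: "x \<in> K" "y \<in> K"
    show "trace_form U x y = trace_form U y x" using K Kr by (intro comm) auto
    assume "z \<in> K"
    then show "trace_form U (bracket x y) z = trace_form U x (bracket y z)"
      using K Kr by (intro invar) auto
  qed (fact subK bil E d)+
  \<comment> \<open>The \<open>K0\<close> component of the witness may be dropped: it acts as zero
    on \<open>U\<close>, and its brackets with \<open>K\<close> lie in
    \<open>K \<inter> K0\<close>.\<close>
  have hypK: "\<exists>x\<in>K. (\<forall>u\<in>U. lam (bracket x u) = 0) \<and> (\<forall>z\<in>K. lam (bracket y z) = mu (bracket x z))"
    if "y \<in> U" for y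
  proof -
    obtain x where x: "x \<in> r" "\<And>u. u \<in> U \<Longrightarrow> lam (bracket x u) = 0"
      "\<And>z. z \<in> r \<Longrightarrow> lam (bracket y z) = mu (bracket x z)"
      using less.prems(4)[OF \<open>y \<in> U\<close>] by blast
    obtain x0 where x0: "x0 \<in> K0" "x - x0 \<in> K" using split(3)[OF x(1)] by blast
    have "lam (bracket (x - x0) u) = 0" if "u \<in> U" for u
      using x(2)[OF that] x0(1) that by (simp add: bracket_simps K0_def)
    moreover have "lam (bracket y z) = mu (bracket (x - x0) z)" if "z \<in> K" for z
    proof -
      have "bracket x0 z \<in> K" using idK x0(1) that by (simp add: K0_def)
      moreover have "bracket z x0 \<in> K0" using K0 x0(1) that Kr unfolding lie_ideal_def by blast
      then have "bracket x0 z \<in> K0"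
        using bracket_anticommute[of x0 z] K0 subspace_neg unfolding lie_ideal_def by metis
      ultimately have "bracket x0 z = 0" using split(2) by blast
      then show ?thesis using x(3)[of z] that Kr by (auto simp: bracket_simps)
    qed
    ultimately show ?thesis using x0(2) by blast
  qed
  have lamC: "lam (C.casimir u) = 0" if "u \<in> U" for u
    by (rule C.functional_casimir_eq_0[OF lam mu subU stabK hypK that])
  show ?case
  proof (cases "E = {}")
    \<comment> \<open>With \<open>K = {0}\<close> all of \<open>r\<close> acts trivially on
      \<open>U\<close>, so \<open>y\<close> is an invariant and hence zero.\<close>
    case True
    then have "K = {0}" using E(3) by simp
    then have "r \<subseteq> K0" using split(3) by fastforce
    then have "bracket x y = 0" if "x \<in> r" for x using that less.prems(5) by (auto simp: K0_def)
    then have "y \<in> invariants r U" using less.prems(5) by (simp add: invariants_def)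
    then show ?thesis using less.prems(3) dual_zero[OF lam] by simp
  next
    case False
    let ?C = "C.casimir"
    note eC = C.endo_casimir
    have CU: "?C u \<in> U" if "u \<in> U" for u
      using C.casimir_in[OF subU stabK that] .
    have powU: "(?C ^^ n) u \<in> U" if "u \<in> U" for n u
      using that by (induction n) (simp_all add: CU)
    define U0 where "U0 = {u \<in> U. \<exists>n. (?C ^^ n) u = 0}"
    have U0_eq: "U0 = U \<inter> gen_eigenspace ?C 0"
      by (auto simp: U0_def gen_eigenspace_def shift_zero)
    have subU0: "subspace U0"
      unfolding U0_eq by (rule subspace_inter[OF subU subspace_gen_eigenspace[OF eC]])
    \<comment> \<open>By duality and symmetry each summand \<open>trace_form U (d e) e\<close>
      equals 1.\<close>
    have "subspace_trace U ?C = of_nat (card E)"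
      unfolding C.trace_casimir[OF subU] using d Kr comm C.E_in_K by (simp add: subset_iff)
    then have "subspace_trace U ?C \<noteq> 0" using of_nat_nonzero[of "card E"] False E(1) by simp
    then have "U0 \<noteq> U"
      using subspace_trace_nilpotent[OF fin_dim_all subU eC] CU unfolding U0_def by blast
    moreover have U0U: "U0 \<subseteq> U" by (auto simp: U0_def)
    ultimately have dim0: "dim U0 < dim U"
      using subspace_dim_equal[OF subU0 subU U0U] by (metis not_le)
    \<comment> \<open>Elements of \<open>r\<close> act on \<open>U\<close> as their \<open>K\<close>
      components, and those commute with the Casimir operator.\<close>
    have stab0: "bracket x u \<in> U0" if "x \<in> r" "u \<in> U0" for x u
    proof -
      obtain n where n: "(?C ^^ n) u = 0" using \<open>u \<in> U0\<close> by (auto simp: U0_def)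
      obtain x0 where x0: "x0 \<in> K0" "x - x0 \<in> K" using split(3)[OF \<open>x \<in> r\<close>] by blast
      have uU: "u \<in> U" using that U0U by blast
      have "bracket x u = bracket (x - x0) u" using x0(1) uU by (simp add: bracket_simps K0_def)
      moreover have "(?C ^^ n) (bracket (x - x0) u) = bracket (x - x0) ((?C ^^ n) u)"
        by (induction n) (simp_all add: C.casimir_commute[OF x0(2)])
      ultimately have "(?C ^^ n) (bracket x u) = 0" using n by (simp add: bracket_simps)
      then show ?thesis using stab[OF \<open>x \<in> r\<close> uU] by (auto simp: U0_def)
    qed
    have lam0: "lam u = 0" if "u \<in> U0" for u
    proof (rule less.hyps[OF dim0 subU0 stab0 _ _ that])
      show "invariants r U0 = {0}"
        using less.prems(3) U0U subspace_0[OF subU0] by (auto simp: invariants_def bracket_simps)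
      show "\<exists>x\<in>r. (\<forall>u\<in>U0. lam (bracket x u) = 0) \<and> (\<forall>z\<in>r. lam (bracket y z) = mu (bracket x z))"
        if "y \<in> U0" for y
        using less.prems(4)[of y] that U0U by blast
    qed
    let ?I = "\<lambda>n. (?C ^^ n) ` U"
    have subI: "subspace (?I n)" for n by (rule endo_image_subspace[OF endo_funpow[OF eC] subU])
    obtain n where n: "\<And>m. dim (?I n) \<le> dim (?I m)"
      using ex_has_least_nat[of "\<lambda>_. True" 0 "\<lambda>n. dim (?I n)"] by blast
    have stable: "?I (k + n) = ?I n" for k
    proof (rule subspace_dim_equal[OF subI subI _ n])
      show "?I (k + n) \<subseteq> ?I n"
      proof
        fix v assume "v \<in> ?I (k + n)"
        then obtain u where "u \<in> U" "v = (?C ^^ n) ((?C ^^ k) u)"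
          by (auto simp: add.commute[of k n] funpow_add)
        then show "v \<in> ?I n" using powU by blast
      qed
    qed
    \<comment> \<open>The images are constant from \<open>n\<close> on. The exponent
      \<open>Suc n\<close> ensures that the summand of \<open>y\<close> in the image contains at
      least one Casimir factor, even for \<open>n = 0\<close>, so that \<open>lam\<close> kills
      it.\<close>
    have "(?C ^^ Suc n) y \<in> ?I (1 + n)" using less.prems(5) by auto
    also have "?I (1 + n) = ?I ((n + 2) + n)" by (simp only: stable)
    finally obtain w where w: "w \<in> U" "(?C ^^ Suc n) y = (?C ^^ ((n + 2) + n)) w" by blast
    have "(n + 2) + n = Suc n + Suc n" by simp
    then have "(?C ^^ Suc n) y = (?C ^^ Suc n) ((?C ^^ Suc n) w)"
      using w(2) by (simp only: funpow_add o_apply)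
    then have "(?C ^^ Suc n) (y - (?C ^^ Suc n) w) = 0"
      using endo_diff[OF endo_funpow[OF eC, of "Suc n"]] by simp
    moreover have "y - (?C ^^ Suc n) w \<in> U"
      using less.prems(5) powU[OF w(1)] subU by (blast intro: subspace_diff)
    ultimately have "y - (?C ^^ Suc n) w \<in> U0" unfolding U0_def by blast
    then have "lam (y - (?C ^^ Suc n) w) = 0" by (rule lam0)
    moreover have "lam ((?C ^^ Suc n) w) = 0" using lamC[OF powU[OF w(1)]] by simp
    ultimately show ?thesis by (simp add: dual_diff[OF lam])
  qed
qed

section \<open>Back to coadjoint orbits of the semidirect sum\<close>

lemma coadjoint_image_eq_iff:
  assumes sum: "semidirect_sum r u" and ab: "abelian u" and ss: "semisimple r"
    and inv: "invariants r u = {0}"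
    and mu: "\<mu> \<in> annihilator u" and nu: "\<nu> \<in> annihilator r" and \<gamma>: "\<gamma> = (\<lambda>x. \<mu> x + \<nu> x)"
  shows "coadjoint_image UNIV \<gamma> = coadjoint_image r \<gamma> \<longleftrightarrow> \<nu> = (\<lambda>x. 0)"
proof -
  have r: "lie_subalgebra r" and u: "subspace u" "\<And>x y. y \<in> u \<Longrightarrow> bracket x y \<in> u"
    and dec: "\<And>x. \<exists>a\<in>r. \<exists>b\<in>u. x = a + b"
    using sum unfolding semidirect_sum_def lie_ideal_def by blast+
  have muD: "\<mu> \<in> dual" "\<And>x. x \<in> u \<Longrightarrow> \<mu> x = 0" and nuD: "\<nu> \<in> dual" "\<And>x. x \<in> r \<Longrightarrow> \<nu> x = 0"
    using mu nu unfolding annihilator_def by auto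
  have u': "bracket y x \<in> u" if "y \<in> u" for x y
    using u(2)[OF that, of x] bracket_anticommute[of y x] u(1) by (simp add: subspace_neg)
  have rr: "bracket x y \<in> r" if "x \<in> r" "y \<in> r" for x y
    using r that unfolding lie_subalgebra_def by blast
  show ?thesis
  proof
    assume eq: "coadjoint_image UNIV \<gamma> = coadjoint_image r \<gamma>"
    have "\<nu> y = 0" if y: "y \<in> u" for y
    proof (rule functional_eq_0[OF r ss nuD(1) muD(1) u(1) _ inv _ y])
      show "bracket x v \<in> u" if "v \<in> u" for x v using u(2) that .
      fix y assume y: "y \<in> u"
      have "coadjoint y \<gamma> \<in> coadjoint_image r \<gamma>"
        using eq unfolding coadjoint_image_def by blast
      then obtain x where x: "x \<in> r" "coadjoint y \<gamma> = coadjoint x \<gamma>"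
        unfolding coadjoint_image_def by blast
      have g: "\<gamma> (bracket y z) = \<gamma> (bracket x z)" for z
        using x(2) by (simp add: coadjoint_def fun_eq_iff)
      \<comment> \<open>Tested on \<open>u\<close>, the side of \<open>y\<close> vanishes since
        \<open>u\<close> is abelian, and \<open>\<mu>\<close> drops out since
        \<open>bracket x v\<close> lies in the ideal. Tested on \<open>r\<close>,
        \<open>bracket y z\<close> lies in \<open>u\<close> and \<open>bracket x z\<close> in
        \<open>r\<close>, so one functional survives on each side.\<close>
      have "\<nu> (bracket x v) = 0" if "v \<in> u" for v
        using g[of v] ab y that u(2)[OF that, of x] muD dual_zero[OF muD(1)] dual_zero[OF nuD(1)]
        by (simp add: \<gamma> abelian_def)
      moreover have "\<nu> (bracket y z) = \<mu> (bracket x z)" if "z \<in> r" for z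
        using g[of z] u'[OF y, of z] rr[OF x(1) that] muD nuD by (simp add: \<gamma>)
      ultimately show "\<exists>x\<in>r. (\<forall>v\<in>u. \<nu> (bracket x v) = 0) \<and> (\<forall>z\<in>r. \<nu> (bracket y z) = \<mu> (bracket x z))"
        using x(1) by blast
    qed
    then show "\<nu> = (\<lambda>x. 0)"
      using dec nuD dual_add[OF nuD(1)] by (metis add.right_neutral)
  next
    assume "\<nu> = (\<lambda>x. 0)"
    then have \<gamma>\<mu>: "\<gamma> = \<mu>" using \<gamma> by simp
    have "coadjoint x \<gamma> \<in> coadjoint_image r \<gamma>" for x
    proof -
      obtain a b where ab: "a \<in> r" "b \<in> u" "x = a + b" using dec by blast
      have "coadjoint x \<gamma> = coadjoint a \<gamma>"
        using muD(2)[OF u'[OF ab(2)]] by (simp add: coadjoint_def fun_eq_iff \<gamma>\<mu> ab(3) bracket_add_left dual_add[OF muD(1)])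
      then show ?thesis using ab(1) unfolding coadjoint_image_def by blast
    qed
    then show "coadjoint_image UNIV \<gamma> = coadjoint_image r \<gamma>"
      unfolding coadjoint_image_def by blast
  qed
qed

end
theorem theorem7:
  shows "(\<forall>(scale :: real \<Rightarrow> 'a::ab_group_add \<Rightarrow> 'a) bracket r u \<gamma> \<mu> \<nu>.
        finite_dim_lie_algebra scale bracket
        \<and> lie_algebra.semidirect_sum scale bracket r u
        \<and> lie_algebra.abelian bracket u
        \<and> lie_algebra.semisimple scale bracket r
        \<and> lie_algebra.invariants bracket r u = {0}
        \<and> \<gamma> \<in> lie_algebra.dual scale
        \<and> \<mu> \<in> lie_algebra.annihilator scale u
        \<and> \<nu> \<in> lie_algebra.annihilator scale r
        \<and> \<gamma> = (\<lambda>x. \<mu> x + \<nu> x)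
        \<longrightarrow> (lie_algebra.coadjoint_image bracket UNIV \<gamma> = lie_algebra.coadjoint_image bracket r \<gamma>
             \<longleftrightarrow> \<nu> = (\<lambda>x. 0)))
    \<and> (\<forall>(scale :: complex \<Rightarrow> 'b::ab_group_add \<Rightarrow> 'b) bracket r u \<gamma> \<mu> \<nu>.
        finite_dim_lie_algebra scale bracket
        \<and> lie_algebra.semidirect_sum scale bracket r u
        \<and> lie_algebra.abelian bracket u
        \<and> lie_algebra.semisimple scale bracket r
        \<and> lie_algebra.invariants bracket r u = {0}
        \<and> \<gamma> \<in> lie_algebra.dual scale
        \<and> \<mu> \<in> lie_algebra.annihilator scale u
        \<and> \<nu> \<in> lie_algebra.annihilator scale r
        \<and> \<gamma> = (\<lambda>x. \<mu> x + \<nu> x)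
        \<longrightarrow> (lie_algebra.coadjoint_image bracket UNIV \<gamma> = lie_algebra.coadjoint_image bracket r \<gamma>
             \<longleftrightarrow> \<nu> = (\<lambda>x. 0)))"
proof (intro conjI allI impI)
  fix scale :: "real \<Rightarrow> 'a \<Rightarrow> 'a" and bracket r u \<gamma> \<mu> \<nu>
  assume hyps: "finite_dim_lie_algebra scale bracket
        \<and> lie_algebra.semidirect_sum scale bracket r u
        \<and> lie_algebra.abelian bracket u
        \<and> lie_algebra.semisimple scale bracket r
        \<and> lie_algebra.invariants bracket r u = {0}
        \<and> \<gamma> \<in> lie_algebra.dual scale
        \<and> \<mu> \<in> lie_algebra.annihilator scale u
        \<and> \<nu> \<in> lie_algebra.annihilator scale r
        \<and> \<gamma> = (\<lambda>x. \<mu> x + \<nu> x)"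
  then interpret finite_dim_lie_algebra scale bracket by blast
  interpret lie_algebra_in_complex scale bracket complex_of_real
    by unfold_locales simp_all
  show "coadjoint_image UNIV \<gamma> = coadjoint_image r \<gamma> \<longleftrightarrow> \<nu> = (\<lambda>x. 0)"
    using hyps by (intro coadjoint_image_eq_iff) auto
next
  fix scale :: "complex \<Rightarrow> 'b \<Rightarrow> 'b" and bracket r u \<gamma> \<mu> \<nu>
  assume hyps: "finite_dim_lie_algebra scale bracket
        \<and> lie_algebra.semidirect_sum scale bracket r u
        \<and> lie_algebra.abelian bracket u
        \<and> lie_algebra.semisimple scale bracket r
        \<and> lie_algebra.invariants bracket r u = {0}
        \<and> \<gamma> \<in> lie_algebra.dual scale
        \<and> \<mu> \<in> lie_algebra.annihilator scale u
        \<and> \<nu> \<in> lie_algebra.annihilator scale r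
        \<and> \<gamma> = (\<lambda>x. \<mu> x + \<nu> x)"
  then interpret finite_dim_lie_algebra scale bracket by blast
  interpret lie_algebra_in_complex scale bracket "\<lambda>c. c"
    by unfold_locales simp_all
  show "coadjoint_image UNIV \<gamma> = coadjoint_image r \<gamma> \<longleftrightarrow> \<nu> = (\<lambda>x. 0)"
    using hyps by (intro coadjoint_image_eq_iff) auto
qed

end
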